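(* Let $\mathcal{T}\subset\mathcal{K}$ be a database of $n$ objects and let $q\in\mathcal{K}$ be a query point. Assume the rank disorder $D$ of $\mathcal{T}\cup\{q\}$ is known. Then there exists a (randomized) data structure on $\mathcal{T}$ with the following properties. Building it requires asking $O(nD^3\log^2 n\,\log\log (n^{D^3}))$ oracle questions in total, and it stores $O(n\log^2 n/\log(2D))$ bits in total. Using it, the nearest neighbor of $q$ in $\mathcal{T}$ is retrieved with high probability by asking $O(D^3\log^2 n\,\log\log (n^{D^3}))$ oracle questions.
   Context: Setting: a hidden space $\mathcal{K}$ with a distance function $d(\cdot,\cdot)$, which need not be a metric; all distances are assumed pairwise distinct. The database is $\mathcal{T}\subset\mathcal{K}$ with $|\mathcal{T}|=n$. The space can only be accessed through a similarity oracle. For $q\in\mathcal{K}$ and $u,v\in\mathcal{T}$, the oracle $O(q,u,v)$ returns $u$ if $d(u,q)\le d(v,q)$ and returns $v$ otherwise. Each oracle call counts as one "question". Ranks: for a set $S$ and objects $u,v$, the rank $r_v(u,S)=c$ if $u$ is the $c$-th nearest object to $v$ in $S$; in particular $r_x(x,S)=0$. Rank disorder: the rank disorder of a set $S$ is the smallest $D$ such that for all $x,y,z\in S$: (1) $r_x(y,S)\le D(r_z(x,S)+r_z(y,S))$; (2) $r_x(y,S)\le D(r_x(z,S)+r_y(z,S))$; (3) $r_x(y,S)\le D(r_x(z,S)+r_z(y,S))$; (4) $r_x(y,S)\le D(r_z(x,S)+r_y(z,S))$. "With high probability" means with probability at least $1-1/n$. *)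

theory Defs
  imports "HOL-Probability.Probability"
begin

text \<open>
  \<open>d u x\<close> is the distance from \<open>u\<close> to the reference object \<open>x\<close>; \<open>d\<close> is not assumed to be
  symmetric or to satisfy a triangle inequality. Distinctness is stated for unordered pairs of
  different objects, so that symmetric \<open>d\<close> are admitted. The first conjunct (an object is nearest
  to itself) is what the convention \<open>r\<^sub>x(x,S) = 0\<close> expresses.
\<close>

definition hidden_space :: "'a set \<Rightarrow> ('a \<Rightarrow> 'a \<Rightarrow> real) \<Rightarrow> bool" where
  "hidden_space K d \<longleftrightarrow>
     (\<forall>x\<in>K. \<forall>y\<in>K. y \<noteq> x \<longrightarrow> d x x < d y x) \<and>
     (\<forall>x\<in>K. \<forall>y\<in>K. \<forall>x'\<in>K. \<forall>y'\<in>K.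
        x \<noteq> y \<and> x' \<noteq> y' \<and> d x y = d x' y' \<longrightarrow> {x, y} = {x', y'})"

definition similarity_oracle :: "('a \<Rightarrow> 'a \<Rightarrow> real) \<Rightarrow> 'a \<Rightarrow> 'a \<Rightarrow> 'a \<Rightarrow> 'a" where
  "similarity_oracle d q u v = (if d u q \<le> d v q then u else v)"

definition nearest_neighbor :: "('a \<Rightarrow> 'a \<Rightarrow> real) \<Rightarrow> 'a set \<Rightarrow> 'a \<Rightarrow> 'a \<Rightarrow> bool" where
  "nearest_neighbor d T q u \<longleftrightarrow> u \<in> T \<and> (\<forall>v\<in>T. d u q \<le> d v q)"

text \<open>
  \<open>obj_rank d S v u\<close> is \<open>r\<^sub>v(u,S)\<close>. The object \<open>v\<close> itself is not counted, so the nearest other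
  object has rank 1.
\<close>

definition obj_rank :: "('a \<Rightarrow> 'a \<Rightarrow> real) \<Rightarrow> 'a set \<Rightarrow> 'a \<Rightarrow> 'a \<Rightarrow> nat" where
  "obj_rank d S v u = card {w \<in> S - {v}. d w v \<le> d u v}"

definition disorder_inequalities :: "('a \<Rightarrow> 'a \<Rightarrow> real) \<Rightarrow> 'a set \<Rightarrow> real \<Rightarrow> bool" where
  "disorder_inequalities d S D \<longleftrightarrow>
     (\<forall>x\<in>S. \<forall>y\<in>S. \<forall>z\<in>S.
        real (obj_rank d S x y) \<le> D * (real (obj_rank d S z x) + real (obj_rank d S z y)) \<and>
        real (obj_rank d S x y) \<le> D * (real (obj_rank d S x z) + real (obj_rank d S y z)) \<and>
        real (obj_rank d S x y) \<le> D * (real (obj_rank d S x z) + real (obj_rank d S z y)) \<and>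
        real (obj_rank d S x y) \<le> D * (real (obj_rank d S z x) + real (obj_rank d S y z)))"

text \<open>
  The constraint \<open>0 \<le> D\<close> only matters when \<open>S\<close> has at most one element; otherwise the
  inequalities with \<open>z = x\<close> force \<open>1 \<le> D\<close>.
\<close>

definition rank_disorder :: "('a \<Rightarrow> 'a \<Rightarrow> real) \<Rightarrow> 'a set \<Rightarrow> real" where
  "rank_disorder d S = (LEAST D. 0 \<le> D \<and> disorder_inequalities d S D)"

text \<open>
  Adaptive algorithms that see the space only through the oracle. Database objects are accessed
  through names, which are natural numbers; \<open>Ask x u v k\<close> asks \<open>O(x,u,v)\<close> and
  continues with \<open>k\<close> applied to the name of the returned object. A randomized algorithm is a
  probability distribution on such trees.
\<close>

datatype ('x, 'r) dtree =
    Answer 'r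
  | Ask 'x nat nat "nat \<Rightarrow> ('x, 'r) dtree"

primrec outcome :: "('x \<Rightarrow> nat \<Rightarrow> nat \<Rightarrow> nat) \<Rightarrow> ('x, 'r) dtree \<Rightarrow> 'r" where
  "outcome orc (Answer r) = r"
| "outcome orc (Ask x u v k) = outcome orc (k (orc x u v))"

primrec asked :: "('x \<Rightarrow> nat \<Rightarrow> nat \<Rightarrow> nat) \<Rightarrow> ('x, 'r) dtree \<Rightarrow> ('x \<times> nat \<times> nat) list" where
  "asked orc (Answer r) = []"
| "asked orc (Ask x u v k) = (x, u, v) # asked orc (k (orc x u v))"

text \<open>
  The reference object of a question is a database object while the structure is being built
  (the query point is not yet available), and a database object or the query point during search.
\<close>

datatype ref = Query | Stored nat

primrec ref_object :: "(nat \<Rightarrow> 'a) \<Rightarrow> 'a \<Rightarrow> ref \<Rightarrow> 'a" where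
  "ref_object obj q Query = q"
| "ref_object obj q (Stored i) = obj i"

definition build_oracle :: "('a \<Rightarrow> 'a \<Rightarrow> real) \<Rightarrow> (nat \<Rightarrow> 'a) \<Rightarrow> nat \<Rightarrow> nat \<Rightarrow> nat \<Rightarrow> nat" where
  "build_oracle d obj x u v = (if similarity_oracle d (obj x) (obj u) (obj v) = obj u then u else v)"

definition search_oracle ::
  "('a \<Rightarrow> 'a \<Rightarrow> real) \<Rightarrow> (nat \<Rightarrow> 'a) \<Rightarrow> 'a \<Rightarrow> ref \<Rightarrow> nat \<Rightarrow> nat \<Rightarrow> nat" where
  "search_oracle d obj q x u v =
     (if similarity_oracle d (ref_object obj q x) (obj u) (obj v) = obj u then u else v)"

end

theory Submission
  imports Defs
begin

text \<open>
  Let \<open>E = \<lceil>D\<rceil>\<close> and \<open>L \<approx> 12 ln n\<close>. Take a hierarchy of random samples of \<open>T\<close>: level \<open>i\<close> contains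
  each object independently with probability \<open>L (17 E)\<^sup>i / n\<close>, the last level is all of \<open>T\<close>. With
  \<open>\<rho>\<^sub>i = n / (17 E)\<^sup>i\<close>, every point has with high probability a level-\<open>i\<close> sample of rank at most
  \<open>\<rho>\<^sub>i\<close>, at most \<open>7 E L\<close> samples of rank at most \<open>2 E \<rho>\<^sub>i\<close>, and at least \<open>7 E L\<close> samples of rank at
  most \<open>17 E \<rho>\<^sub>i\<close>. Hence the beam of \<open>x\<close>, its \<open>7 E L\<close> nearest samples, lies between the balls of
  radius \<open>2 E \<rho>\<^sub>i\<close> and \<open>17 E \<rho>\<^sub>i\<close>.

  Each object of level \<open>i + 1\<close> stores only a pointer to its nearest sample in level \<open>i\<close>, its parent.
  A sample \<open>y\<close> of level \<open>i + 1\<close> with \<open>r\<^sub>x(y) \<le> 17 E \<rho>\<^sub>i\<^sub>+\<^sub>1 = \<rho>\<^sub>i\<close> has a parent of rank at most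
  \<open>E (\<rho>\<^sub>i + \<rho>\<^sub>i)\<close> about \<open>x\<close>, that is, in the beam; so the next beam can be selected among the
  children of the current one. Conversely these children have rank at most
  \<open>E (17 E \<rho>\<^sub>i + \<rho>\<^sub>i) = O(E\<^sup>3 \<rho>\<^sub>i\<^sub>+\<^sub>1)\<close>, so there are only \<open>O(E\<^sup>3 L)\<close> of them, and merge sort finds the
  new beam with \<open>O(D\<^sup>3 log n log (D\<^sup>3 log n))\<close> questions per level. The parents themselves are found
  during construction by running the same search for every database object.
\<close>

section \<open>Decision trees\<close>

primrec bind_tree :: "('x, 'r) dtree \<Rightarrow> ('r \<Rightarrow> ('x, 's) dtree) \<Rightarrow> ('x, 's) dtree" where
  "bind_tree (Answer r) f = f r"
| "bind_tree (Ask x u v k) f = Ask x u v (\<lambda>w. bind_tree (k w) f)"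

lemma outcome_bind_tree [simp]:
  "outcome orc (bind_tree t f) = outcome orc (f (outcome orc t))"
  by (induction t) auto

lemma asked_bind_tree [simp]:
  "asked orc (bind_tree t f) = asked orc t @ asked orc (f (outcome orc t))"
  by (induction t) auto

primrec map_tree :: "('b \<Rightarrow> ('x, 'c) dtree) \<Rightarrow> 'b list \<Rightarrow> ('x, 'c list) dtree" where
  "map_tree f [] = Answer []"
| "map_tree f (b # bs) = bind_tree (f b) (\<lambda>c. bind_tree (map_tree f bs) (\<lambda>cs. Answer (c # cs)))"

lemma outcome_map_tree [simp]: "outcome orc (map_tree f bs) = map (\<lambda>b. outcome orc (f b)) bs"
  by (induction bs) auto

lemma asked_map_tree [simp]: "asked orc (map_tree f bs) = concat (map (\<lambda>b. asked orc (f b)) bs)"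
  by (induction bs) auto

section \<open>Merge sort with oracle comparisons\<close>

fun merge_tree :: "'x \<Rightarrow> nat list \<Rightarrow> nat list \<Rightarrow> ('x, nat list) dtree" where
  "merge_tree x [] vs = Answer vs"
| "merge_tree x us [] = Answer us"
| "merge_tree x (u # us) (v # vs) = Ask x u v (\<lambda>w.
     if w = u then bind_tree (merge_tree x us (v # vs)) (\<lambda>ws. Answer (u # ws))
     else bind_tree (merge_tree x (u # us) vs) (\<lambda>ws. Answer (v # ws)))"

text \<open>Any sorting method with O(m log m) comparisons would serve; halving lets the question
  count follow powers of two. The defining equation matches every list, so it is kept out of the
  simplifier and unfolded once where needed.\<close>

fun sort_tree :: "'x \<Rightarrow> nat list \<Rightarrow> ('x, nat list) dtree" where
  "sort_tree x us = (if length us \<le> 1 then Answer us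
     else bind_tree (sort_tree x (take (length us div 2) us)) (\<lambda>vs.
          bind_tree (sort_tree x (drop (length us div 2) us)) (\<lambda>ws. merge_tree x vs ws)))"

declare sort_tree.simps [simp del]

text \<open>\<open>key x\<close> is the distance to the reference that \<open>x\<close> names. This
  form covers the build oracle and the search oracle at once, so sorting is analysed only
  once.\<close>

definition compares :: "('x \<Rightarrow> nat \<Rightarrow> nat \<Rightarrow> nat) \<Rightarrow> ('x \<Rightarrow> nat \<Rightarrow> real) \<Rightarrow> bool" where
  "compares orc key \<longleftrightarrow> (\<forall>x u v. orc x u v = (if key x u \<le> key x v then u else v))"

lemma mset_outcome_merge_tree [simp]:
  "mset (outcome orc (merge_tree x us vs)) = mset us + mset vs"
  by (induction x us vs rule: merge_tree.induct) auto

lemma set_outcome_merge_tree [simp]: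
  "set (outcome orc (merge_tree x us vs)) = set us \<union> set vs"
  using mset_outcome_merge_tree[of orc x us vs] by (metis set_mset_mset set_mset_union)

lemma sorted_outcome_merge_tree:
  assumes "compares orc key" "sorted (map (key x) us)" "sorted (map (key x) vs)"
  shows "sorted (map (key x) (outcome orc (merge_tree x us vs)))"
  using assms
proof (induction x us vs rule: merge_tree.induct)
  case (3 x u us v vs)
  show ?case
  proof (cases "key x u \<le> key x v")
    case True
    then have "orc x u v = u"
      using "3.prems"(1) by (simp add: compares_def)
    moreover have "key x u \<le> key x w" if "w \<in> set us \<union> set (v # vs)" for w
      using that True "3.prems" by auto
    ultimately show ?thesis
      using "3.IH"(1)[of u] "3.prems" by simp
  next
    case False
    then have "orc x u v = v" "v \<noteq> u"
      using "3.prems"(1) by (auto simp: compares_def)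
    moreover have "key x v \<le> key x w" if "w \<in> set (u # us) \<union> set vs" for w
      using that False "3.prems" by auto
    ultimately show ?thesis
      using "3.IH"(2)[of v] "3.prems" by simp
  qed
qed auto

lemma length_asked_merge_tree:
  "length (asked orc (merge_tree x us vs)) \<le> length us + length vs"
  by (induction x us vs rule: merge_tree.induct) auto

lemma set_asked_merge_tree:
  assumes "set us \<subseteq> A" "set vs \<subseteq> A"
  shows "set (asked orc (merge_tree x us vs)) \<subseteq> {x} \<times> A \<times> A"
  using assms
proof (induction x us vs rule: merge_tree.induct)
  case (3 x u us v vs)
  then show ?case
    by (cases "orc x u v = u") simp_all
qed simp_all

lemma mset_outcome_sort_tree [simp]: "mset (outcome orc (sort_tree x us)) = mset us"
proof (induction x us rule: sort_tree.induct)
  case (1 x us)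
  show ?case
  proof (cases "length us \<le> 1")
    case True
    then show ?thesis
      by (subst sort_tree.simps) simp
  next
    case False
    have "mset (take (length us div 2) us) + mset (drop (length us div 2) us) = mset us"
      by (metis append_take_drop_id mset_append)
    with False 1 show ?thesis
      by (subst sort_tree.simps) simp
  qed
qed

lemma set_outcome_sort_tree [simp]: "set (outcome orc (sort_tree x us)) = set us"
  using mset_outcome_sort_tree[of orc x us] by (metis set_mset_mset)

lemma distinct_outcome_sort_tree [simp]: "distinct (outcome orc (sort_tree x us)) = distinct us"
  using mset_outcome_sort_tree[of orc x us] by (metis distinct_count_atmost_1 set_mset_mset)

lemma sorted_outcome_sort_tree:
  assumes "compares orc key"
  shows "sorted (map (key x) (outcome orc (sort_tree x us)))"
proof (induction x us rule: sort_tree.induct)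
  case (1 x us)
  show ?case
  proof (cases "length us \<le> 1")
    case True
    then show ?thesis
      by (subst sort_tree.simps) (auto simp: le_Suc_eq length_Suc_conv)
  next
    case False
    with 1 show ?thesis
      by (subst sort_tree.simps) (simp add: sorted_outcome_merge_tree[OF assms])
  qed
qed

lemma set_asked_sort_tree:
  assumes "set us \<subseteq> A"
  shows "set (asked orc (sort_tree x us)) \<subseteq> {x} \<times> A \<times> A"
  using assms
proof (induction x us rule: sort_tree.induct)
  case (1 x us)
  show ?case
  proof (cases "length us \<le> 1")
    case True
    then show ?thesis
      by (subst sort_tree.simps) simp
  next
    case False
    let ?l = "length us div 2"
    have sub: "set (take ?l us) \<subseteq> A" "set (drop ?l us) \<subseteq> A"
      using "1.prems" set_take_subset[of ?l us] set_drop_subset[of ?l us] by blast+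
    then show ?thesis
      using False "1.IH"(1)[OF False sub(1)] "1.IH"(2)[OF False sub(2)]
      by (subst sort_tree.simps) (simp add: set_asked_merge_tree)
  qed
qed

text \<open>\<open>k\<close> bounds the recursion depth, and the merges at one depth together ask at
  most one question per element. With a power of two as bound, the larger of two unequal halves
  still has length at most \<open>2 ^ k\<close>.\<close>

lemma length_asked_sort_tree:
  assumes "length us \<le> 2 ^ k"
  shows "length (asked orc (sort_tree x us)) \<le> k * length us"
  using assms
proof (induction k arbitrary: us)
  case 0
  then show ?case
    by (subst sort_tree.simps) auto
next
  case (Suc k)
  show ?case
  proof (cases "length us \<le> 1")
    case True
    then show ?thesis
      by (subst sort_tree.simps) auto
  next
    case False
    let ?l = "length us div 2"
    let ?a = "take ?l us" and ?b = "drop ?l us"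
    have len: "length ?a \<le> 2 ^ k" "length ?b \<le> 2 ^ k" "length ?a + length ?b = length us"
      using Suc.prems by auto
    have out: "length (outcome orc (sort_tree x vs)) = length vs" for vs
      by (metis mset_outcome_sort_tree size_mset)
    have "length (asked orc (sort_tree x us)) \<le> k * length ?a + (k * length ?b + length us)"
      using False Suc.IH[OF len(1)] Suc.IH[OF len(2)] len(3)
        length_asked_merge_tree[of orc x "outcome orc (sort_tree x ?a)" "outcome orc (sort_tree x ?b)"]
      by (subst sort_tree.simps) (simp add: out)
    also have "\<dots> = Suc k * length us"
      using len(3) by (metis add.assoc add.commute distrib_left mult_Suc)
    finally show ?thesis .
  qed
qed

text \<open>In a strictly increasing list the index of an entry is the number of smaller keys.
  Membership in a beam thus becomes a counting condition that does not mention the list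
  order.\<close>

lemma in_set_take_sorted_iff:
  fixes key :: "'b \<Rightarrow> real"
  assumes "distinct us" "sorted (map key us)" "inj_on key (set us)"
  shows "z \<in> set (take k us) \<longleftrightarrow> z \<in> set us \<and> card {w \<in> set us. key w < key z} < k"
proof -
  have "card {w \<in> set us. key w < key (us ! j)} = j" if "j < length us" for j
  proof -
    have "{w \<in> set us. key w < key (us ! j)} = (!) us ` {..<j}"
    proof (intro equalityI subsetI)
      fix w assume "w \<in> {w \<in> set us. key w < key (us ! j)}"
      then obtain i where i: "i < length us" "w = us ! i" "key (us ! i) < key (us ! j)"
        by (auto simp: in_set_conv_nth)
      have "i < j"
      proof (rule ccontr)
        assume "\<not> i < j"
        then have "key (us ! j) \<le> key (us ! i)"
          using sorted_nth_mono[OF assms(2), of j i] i(1) that by auto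
        with i show False by simp
      qed
      with i show "w \<in> (!) us ` {..<j}" by auto
    next
      fix w assume "w \<in> (!) us ` {..<j}"
      then obtain i where i: "i < j" "w = us ! i" by auto
      then have "key (us ! i) \<le> key (us ! j)"
        using sorted_nth_mono[OF assms(2), of i j] that by auto
      moreover have "us ! i \<noteq> us ! j"
        using assms(1) i that by (simp add: nth_eq_iff_index_eq)
      then have "key (us ! i) \<noteq> key (us ! j)"
        using assms(3) i that by (auto dest: inj_onD)
      ultimately show "w \<in> {w \<in> set us. key w < key (us ! j)}"
        using i that by auto
    qed
    moreover have "inj_on ((!) us) {..<j}"
      using assms(1) that by (intro inj_on_nth) auto
    ultimately show ?thesis
      by (simp add: card_image)
  qed
  then show ?thesis
    by (auto simp: in_set_conv_nth[of z])
qed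

section \<open>Ranks\<close>

text \<open>Ranks only compare distances to a common reference, so injectivity in the first argument
  of \<open>d\<close> is all that is kept of the distinctness of distances.\<close>

locale ranked_set =
  fixes d :: "'a \<Rightarrow> 'a \<Rightarrow> real" and S :: "'a set"
  assumes finite_S: "finite S"
    and self_nearest: "\<And>x y. x \<in> S \<Longrightarrow> y \<in> S \<Longrightarrow> y \<noteq> x \<Longrightarrow> d x x < d y x"
    and dist_inject: "\<And>x y z. x \<in> S \<Longrightarrow> y \<in> S \<Longrightarrow> z \<in> S \<Longrightarrow> d y x = d z x \<Longrightarrow> y = z"
begin

abbreviation rank :: "'a \<Rightarrow> 'a \<Rightarrow> nat" where
  "rank \<equiv> obj_rank d S"

lemma rank_mono:
  assumes "d y x \<le> d z x"
  shows "rank x y \<le> rank x z"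
  unfolding obj_rank_def using assms finite_S by (intro card_mono) auto

lemma rank_strict_mono:
  assumes "x \<in> S" "y \<in> S" "z \<in> S" "d y x < d z x"
  shows "rank x y < rank x z"
proof -
  \<comment> \<open>A rank does not count its reference, so the witness \<open>z\<close> for
    strictness has to differ from \<open>x\<close>.\<close>
  have "z \<noteq> x"
    using self_nearest[of x y] assms by (cases "y = x") auto
  then have "z \<in> {w \<in> S - {x}. d w x \<le> d z x} - {w \<in> S - {x}. d w x \<le> d y x}"
    using assms by simp
  moreover have "{w \<in> S - {x}. d w x \<le> d y x} \<subseteq> {w \<in> S - {x}. d w x \<le> d z x}"
    using assms(4) by auto
  ultimately have "{w \<in> S - {x}. d w x \<le> d y x} \<subset> {w \<in> S - {x}. d w x \<le> d z x}"
    by blast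
  then show ?thesis
    unfolding obj_rank_def using finite_S by (intro psubset_card_mono) auto
qed

lemma rank_le_iff:
  assumes "x \<in> S" "y \<in> S" "z \<in> S"
  shows "rank x y \<le> rank x z \<longleftrightarrow> d y x \<le> d z x"
  using rank_mono[of y x z] rank_strict_mono[of x z y] assms by force

lemma rank_less_iff:
  assumes "x \<in> S" "y \<in> S" "z \<in> S"
  shows "rank x y < rank x z \<longleftrightarrow> d y x < d z x"
  using rank_le_iff[of x z y] assms by auto

lemma rank_less_card:
  assumes "x \<in> S"
  shows "rank x y < card S"
proof -
  have "rank x y \<le> card (S - {x})"
    unfolding obj_rank_def using finite_S by (intro card_mono) auto
  also have "\<dots> < card S"
    using assms finite_S by (intro psubset_card_mono) auto
  finally show ?thesis .
qed

lemma rank_self [simp]: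
  assumes "x \<in> S"
  shows "rank x x = 0"
proof -
  have "{w \<in> S - {x}. d w x \<le> d x x} = {}"
    using self_nearest[of x] assms by force
  then show ?thesis
    by (simp only: obj_rank_def card.empty)
qed

lemma inj_on_rank:
  assumes "x \<in> S"
  shows "inj_on (rank x) S"
proof (rule inj_onI)
  fix y z assume yz: "y \<in> S" "z \<in> S" "rank x y = rank x z"
  then have "d y x = d z x"
    using rank_le_iff[OF assms, of y z] rank_le_iff[OF assms, of z y] by auto
  then show "y = z"
    using dist_inject assms yz by blast
qed

lemma rank_eq_0_iff:
  assumes "x \<in> S" "y \<in> S"
  shows "rank x y = 0 \<longleftrightarrow> y = x"
  using inj_on_rank[OF assms(1)] rank_self[OF assms(1)] assms by (metis inj_onD)

lemma rank_image:
  assumes "x \<in> S"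
  shows "rank x ` S = {..<card S}"
proof (rule card_subset_eq)
  show "rank x ` S \<subseteq> {..<card S}"
    using rank_less_card assms by auto
  show "card (rank x ` S) = card {..<card S}"
    using inj_on_rank[OF assms] by (simp add: card_image)
qed simp

text \<open>The ranks about \<open>x\<close> run bijectively through 0, ...,
  \<open>card S - 1\<close>; the \<open>Suc\<close> comes from \<open>x\<close> itself, which has
  rank 0.\<close>

lemma card_rank_le:
  assumes "x \<in> S"
  shows "card {y \<in> S. rank x y \<le> k} = min (Suc k) (card S)"
proof -
  have "rank x ` {y \<in> S. rank x y \<le> k} = {..<min (Suc k) (card S)}"
  proof -
    have "rank x ` {y \<in> S. rank x y \<le> k} = rank x ` S \<inter> {..k}"
      by auto
    then show ?thesis
      by (auto simp: rank_image[OF assms])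
  qed
  moreover have "inj_on (rank x) {y \<in> S. rank x y \<le> k}"
    using inj_on_rank[OF assms] by (rule inj_on_subset) auto
  ultimately show ?thesis
    by (metis card_image card_lessThan)
qed

text \<open>Makes the set of admissible constants nonempty. The two ranks on a right-hand side
  either both vanish, which forces x = z = y, or their sum is at least 1, while every rank is below
  \<open>card S\<close>.\<close>

lemma disorder_inequalities_card: "disorder_inequalities d S (real (card S))"
proof -
  have *: "real (rank x y) \<le> real (card S) * (real a + real b)"
    if "x \<in> S" "y \<in> S" "a = 0 \<Longrightarrow> b = 0 \<Longrightarrow> y = x" for x y and a b :: nat
  proof (cases "a + b = 0")
    case True
    with that show ?thesis by auto
  next
    case False
    then have "real (card S) * 1 \<le> real (card S) * (real a + real b)"
      by (intro mult_left_mono) auto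
    then show ?thesis
      using rank_less_card[of x y] that(1) by linarith
  qed
  show ?thesis
    unfolding disorder_inequalities_def
  proof (intro ballI conjI)
    fix x y z assume "x \<in> S" "y \<in> S" "z \<in> S"
    note S = this
    show "real (rank x y) \<le> real (card S) * (real (rank z x) + real (rank z y))"
      "real (rank x y) \<le> real (card S) * (real (rank x z) + real (rank y z))"
      "real (rank x y) \<le> real (card S) * (real (rank x z) + real (rank z y))"
      "real (rank x y) \<le> real (card S) * (real (rank z x) + real (rank y z))"
      using S by (metis * rank_eq_0_iff)+
  qed
qed

text \<open>A \<open>LEAST\<close> over the reals need not be attained. Here the constraints are
  non-strict and continuous in \<open>D\<close>, so the admissible set is closed, bounded below by 0
  and nonempty, and contains its infimum. The upper bound later gives ln(2D) = O(log n).\<close>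

lemma rank_disorder_least:
  shows "disorder_inequalities d S (rank_disorder d S)"
    and "rank_disorder d S \<le> real (card S)"
proof -
  define V where "V = {D. 0 \<le> D \<and> disorder_inequalities d S D}"
  have "closed V"
    unfolding V_def disorder_inequalities_def Collect_ball_eq Collect_conj_eq
    by (intro closed_Int closed_INT ballI closed_Collect_le continuous_intros)
  moreover have card_V: "real (card S) \<in> V"
    using disorder_inequalities_card by (simp add: V_def)
  moreover have bdd: "bdd_below V"
    by (rule bdd_belowI[of _ 0]) (simp add: V_def)
  ultimately have "Inf V \<in> V"
    by (intro closed_contains_Inf) auto
  moreover have "Inf V \<le> D" if "D \<in> V" for D
    using that bdd by (rule cInf_lower)
  ultimately have "rank_disorder d S = Inf V"
    unfolding rank_disorder_def by (intro Least_equality) (auto simp: V_def)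
  with \<open>Inf V \<in> V\<close> card_V \<open>\<And>D. D \<in> V \<Longrightarrow> Inf V \<le> D\<close>
  show "disorder_inequalities d S (rank_disorder d S)" "rank_disorder d S \<le> real (card S)"
    by (auto simp: V_def)
qed

lemma disorder_inequalities_ge_1:
  assumes "disorder_inequalities d S D" "x \<in> S" "y \<in> S" "x \<noteq> y"
  shows "1 \<le> D"
proof -
  have "real (rank x y) \<le> D * (real (rank x x) + real (rank x y))"
    using assms(1)[unfolded disorder_inequalities_def, rule_format, OF assms(2,3,2)] by blast
  moreover have "rank x y > 0"
    using rank_eq_0_iff[of x y] assms by auto
  ultimately show ?thesis
    using assms by simp
qed

end

text \<open>Ranks are nonnegative, so right-hand sides grow with the constant. This permits rounding
  the disorder up to an integer.\<close>

lemma disorder_inequalities_mono: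
  assumes "disorder_inequalities d S D" "D \<le> D'"
  shows "disorder_inequalities d S D'"
proof -
  have le: "D * (real b + real c) \<le> D' * (real b + real c)" for b c
    using assms(2) by (intro mult_right_mono) auto
  show ?thesis
    using assms(1) unfolding disorder_inequalities_def
    by (intro ballI conjI; intro order_trans[OF _ le]) simp_all
qed

lemma ranked_set_hidden_space:
  assumes "hidden_space K d" "finite S" "S \<subseteq> K"
  shows "ranked_set d S"
proof
  have self: "d x x < d y x" if "x \<in> S" "y \<in> S" "y \<noteq> x" for x y
    using assms(1,3) that unfolding hidden_space_def by (simp add: subset_iff)
  then show "\<And>x y. x \<in> S \<Longrightarrow> y \<in> S \<Longrightarrow> y \<noteq> x \<Longrightarrow> d x x < d y x" .
  fix x y z assume *: "x \<in> S" "y \<in> S" "z \<in> S" "d y x = d z x"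
  show "y = z"
  \<comment> \<open>Distinctness of distances only concerns pairs of different objects; if
    \<open>y\<close> or \<open>z\<close> is the reference itself, strict nearness of
    \<open>x\<close> to itself decides.\<close>
  proof (cases "y = x \<or> z = x")
    case True
    then show ?thesis
      using self[of x y] self[of x z] * by force
  next
    case False
    then have "{y, x} = {z, x}"
      using assms(1) *(4) *(1-3)[THEN subsetD[OF assms(3)]] unfolding hidden_space_def by meson
    with False show ?thesis by auto
  qed
qed fact

section \<open>Tails of random subsets\<close>

lemma finite_set_pmf_Pi_bernoulli:
  assumes "finite A"
  shows "finite (set_pmf (Pi_pmf A False (\<lambda>a. bernoulli_pmf (w a))))"
  using assms by (auto simp: set_Pi_pmf intro!: finite_PiE_dflt)

text \<open>The moment generating function of a binomial count: the exponential splits into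
  independent factors, and coordinates outside \<open>B\<close> contribute 1. The weight is constant
  only on \<open>B\<close>, because weights vary between levels.\<close>

lemma expectation_exp_card:
  fixes s :: real
  assumes "finite A" "B \<subseteq> A" "\<And>a. a \<in> B \<Longrightarrow> w a = p" "0 \<le> p" "p \<le> 1"
  shows "measure_pmf.expectation (Pi_pmf A False (\<lambda>a. bernoulli_pmf (w a)))
           (\<lambda>\<omega>. exp (s * real (card {a \<in> B. \<omega> a}))) = (1 + p * (exp s - 1)) ^ card B"
proof -
  define f where "f a v = (if a \<in> B \<and> v then exp s else 1)" for a v
  have "(\<Prod>a\<in>A. f a (\<omega> a)) = exp (s * real (card {a \<in> B. \<omega> a}))" for \<omega>
  proof -
    have "{a \<in> A. a \<in> B \<and> \<omega> a} = {a \<in> B. \<omega> a}"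
      using assms(2) by auto
    then have "(\<Prod>a\<in>A. f a (\<omega> a)) = exp s ^ card {a \<in> B. \<omega> a}"
      unfolding f_def using assms(1)
      by (simp add: prod.inter_filter[symmetric] del: prod.inter_filter)
    then show ?thesis
      by (simp add: exp_of_nat_mult[symmetric] mult.commute)
  qed
  then have "measure_pmf.expectation (Pi_pmf A False (\<lambda>a. bernoulli_pmf (w a)))
           (\<lambda>\<omega>. exp (s * real (card {a \<in> B. \<omega> a}))) =
        measure_pmf.expectation (Pi_pmf A False (\<lambda>a. bernoulli_pmf (w a)))
           (\<lambda>\<omega>. \<Prod>a\<in>A. f a (\<omega> a))"
    by simp
  also have "\<dots> = (\<Prod>a\<in>A. measure_pmf.expectation (bernoulli_pmf (w a)) (f a))"
    using assms(1)
    by (intro expectation_prod_Pi_pmf integrable_measure_pmf_finite) (auto simp: f_def)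
  also have "\<dots> = (\<Prod>a\<in>A. if a \<in> B then 1 + p * (exp s - 1) else 1)"
    using assms by (intro prod.cong refl) (auto simp: f_def[abs_def] algebra_simps)
  also have "\<dots> = (\<Prod>a\<in>{a \<in> A. a \<in> B}. 1 + p * (exp s - 1))"
    using assms(1) by (subst prod.inter_filter) auto
  also have "{a \<in> A. a \<in> B} = B"
    using assms(2) by auto
  finally show ?thesis by simp
qed

text \<open>The Chernoff argument: Markov's inequality for the exponential, then
  \<open>1 + t \<le> exp t\<close>. Comparing exponentials leaves the sign of \<open>s\<close> open,
  so both tails follow.\<close>

lemma prob_card_exp_bound:
  fixes s :: real
  assumes "finite A" "B \<subseteq> A" "\<And>a. a \<in> B \<Longrightarrow> w a = p" "0 \<le> p" "p \<le> 1"
  shows "measure_pmf.prob (Pi_pmf A False (\<lambda>a. bernoulli_pmf (w a)))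
           {\<omega>. exp (s * real (card {a \<in> B. \<omega> a})) \<ge> exp c}
         \<le> exp (p * (exp s - 1) * real (card B) - c)"
proof -
  let ?M = "measure_pmf (Pi_pmf A False (\<lambda>a. bernoulli_pmf (w a)))"
  \<comment> \<open>Raising to a power is monotone only for a nonnegative base; for negative
    \<open>s\<close> this is seen by writing it as a convex combination of 1 and
    \<open>exp s\<close>.\<close>
  have "0 \<le> 1 + p * (exp s - 1)"
  proof -
    have "0 \<le> (1 - p) + p * exp s"
      using assms by simp
    then show ?thesis by (simp add: algebra_simps)
  qed
  then have *: "(1 + p * (exp s - 1)) ^ card B \<le> exp (p * (exp s - 1)) ^ card B"
    by (intro power_mono) auto
  have "measure ?M {\<omega> \<in> space ?M. exp (s * real (card {a \<in> B. \<omega> a})) \<ge> exp c}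
          \<le> measure_pmf.expectation (Pi_pmf A False (\<lambda>a. bernoulli_pmf (w a)))
               (\<lambda>\<omega>. exp (s * real (card {a \<in> B. \<omega> a}))) / exp c"
    using assms(1)
    by (intro integral_Markov_inequality_measure[where A = UNIV] integrable_measure_pmf_finite
          finite_set_pmf_Pi_bernoulli) auto
  also have "\<dots> \<le> exp (p * (exp s - 1)) ^ card B / exp c"
    using * by (subst expectation_exp_card[OF assms]) (auto intro: divide_right_mono)
  also have "\<dots> = exp (p * (exp s - 1) * real (card B) - c)"
    by (simp add: exp_diff exp_of_nat_mult[symmetric] mult.commute)
  finally show ?thesis by simp
qed

text \<open>Chernoff with s = 1, where e - 1 is at most 2.\<close>

lemma prob_card_ge:
  assumes "finite A" "B \<subseteq> A" "\<And>a. a \<in> B \<Longrightarrow> w a = p" "0 \<le> p" "p \<le> 1"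
    and "p * real (card B) \<le> \<mu>"
  shows "measure_pmf.prob (Pi_pmf A False (\<lambda>a. bernoulli_pmf (w a)))
           {\<omega>. k \<le> real (card {a \<in> B. \<omega> a})} \<le> exp (2 * \<mu> - k)"
proof -
  have "p * real (card B) * (exp 1 - 1) \<le> p * real (card B) * 2"
    using exp_le assms(4) by (intro mult_left_mono) auto
  then have "p * (exp 1 - 1) * real (card B) \<le> 2 * \<mu>"
    using assms(6) by (simp add: algebra_simps)
  then show ?thesis
    using prob_card_exp_bound[where w = w and s = 1 and c = k, OF assms(1-5)] by (auto intro: order_trans)
qed

text \<open>Chernoff with s = -1, where 1 - 1/e is at least 1/2.\<close>

lemma prob_card_le:
  assumes "finite A" "B \<subseteq> A" "\<And>a. a \<in> B \<Longrightarrow> w a = p" "0 \<le> p" "p \<le> 1"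
    and "\<mu> \<le> p * real (card B)"
  shows "measure_pmf.prob (Pi_pmf A False (\<lambda>a. bernoulli_pmf (w a)))
           {\<omega>. real (card {a \<in> B. \<omega> a}) \<le> k} \<le> exp (k - \<mu> / 2)"
proof -
  have "exp (- 1 :: real) = 1 / exp 1"
    by (simp add: exp_minus field_simps)
  moreover have "1 / exp (1 :: real) \<le> 1 / 2"
    using exp_ge_add_one_self[of 1] by (intro divide_left_mono) auto
  ultimately have "p * real (card B) * (1 - exp (- 1)) \<ge> p * real (card B) * (1 / 2)"
    using assms(4) by (intro mult_left_mono) auto
  then have "p * (exp (- 1) - 1) * real (card B) + k \<le> k - \<mu> / 2"
    using assms(6) by (simp add: algebra_simps)
  then show ?thesis
    using prob_card_exp_bound[where w = w and s = "- 1" and c = "- k", OF assms(1-5)] by (auto intro: order_trans)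
qed

section \<open>Beam search through a hierarchy of samples\<close>

definition head_or :: "nat \<Rightarrow> nat list \<Rightarrow> nat" where
  "head_or n B = (case B of [] \<Rightarrow> n | z # _ \<Rightarrow> z)"

text \<open>The name \<open>n\<close> is no object; as an entry of a table it marks the objects outside the sample.\<close>

definition parent_table :: "nat \<Rightarrow> nat set \<Rightarrow> nat list list \<Rightarrow> nat list" where
  "parent_table n M Bs = map (\<lambda>y. if y \<in> M then head_or n (Bs ! y) else n) [0..<n]"

text \<open>Finding the children of a beam reads only the table and costs no question. Cutting the
  candidates at \<open>kc\<close> makes the question bound hold for every outcome of the sampling;
  for good samples nothing is cut off.\<close>

definition step_tree ::
  "nat \<Rightarrow> nat \<Rightarrow> nat \<Rightarrow> 'x \<Rightarrow> nat list \<Rightarrow> nat list \<Rightarrow> ('x, nat list) dtree" where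
  "step_tree n kc kb x tab B =
     bind_tree (sort_tree x (take kc (filter (\<lambda>y. tab ! y \<in> set B) [0..<n])))
       (\<lambda>ys. Answer (take kb ys))"

fun search_tree :: "nat \<Rightarrow> nat \<Rightarrow> nat \<Rightarrow> nat list list \<Rightarrow> nat list \<Rightarrow> (ref, nat) dtree" where
  "search_tree n kc kb [] B = Answer (head_or n B)"
| "search_tree n kc kb (tab # tabs) B =
     bind_tree (step_tree n kc kb Query tab B) (search_tree n kc kb tabs)"

text \<open>\<open>Bs\<close> carries the current beam of every object, not just of the samples,
  since every object needs a parent at the last level. All objects advance together because a step
  needs the whole table of its level.\<close>

fun build_tree ::
  "nat \<Rightarrow> nat \<Rightarrow> nat \<Rightarrow> nat set list \<Rightarrow> nat list list \<Rightarrow> (nat, nat list list) dtree" where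
  "build_tree n kc kb [] Bs = Answer []"
| "build_tree n kc kb (M # Ms) Bs =
     bind_tree (map_tree (\<lambda>y. step_tree n kc kb y (parent_table n M Bs) (Bs ! y)) [0..<n])
       (\<lambda>Bs'. bind_tree (build_tree n kc kb Ms Bs')
          (\<lambda>tabs. Answer (parent_table n M Bs # tabs)))"

section \<open>Question counts and shape of the tables, for every outcome of the sampling\<close>

lemma set_outcome_step_tree: "set (outcome orc (step_tree n kc kb x tab B)) \<subseteq> {..<n}"
  unfolding step_tree_def by (auto dest!: in_set_takeD)

lemma length_asked_step_tree:
  assumes "kc \<le> 2 ^ k"
  shows "length (asked orc (step_tree n kc kb x tab B)) \<le> k * kc"
proof -
  let ?us = "take kc (filter (\<lambda>y. tab ! y \<in> set B) [0..<n])"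
  have "length (asked orc (sort_tree x ?us)) \<le> k * length ?us"
    using assms by (intro length_asked_sort_tree) auto
  also have "\<dots> \<le> k * kc"
    by (intro mult_left_mono) auto
  finally show ?thesis
    by (simp add: step_tree_def)
qed

lemma set_asked_step_tree:
  "set (asked orc (step_tree n kc kb x tab B)) \<subseteq> {x} \<times> {..<n} \<times> {..<n}"
proof -
  have "set (take kc (filter (\<lambda>y. tab ! y \<in> set B) [0..<n])) \<subseteq> {..<n}"
    by (auto dest!: in_set_takeD)
  from set_asked_sort_tree[OF this] show ?thesis
    by (simp add: step_tree_def)
qed

lemma length_asked_search_tree:
  assumes "kc \<le> 2 ^ k"
  shows "length (asked orc (search_tree n kc kb tabs B)) \<le> length tabs * (k * kc)"
proof (induction tabs arbitrary: B)
  case (Cons tab tabs)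
  then show ?case
    using length_asked_step_tree[OF assms, of orc n kb Query tab B] by (simp add: add_mono)
qed simp

lemma set_asked_search_tree:
  "set (asked orc (search_tree n kc kb tabs B)) \<subseteq> {Query} \<times> {..<n} \<times> {..<n}"
proof (induction tabs arbitrary: B)
  case (Cons tab tabs)
  then show ?case
    using set_asked_step_tree[of orc n kc kb Query tab B] by simp
qed simp

lemma length_asked_build_tree:
  assumes "kc \<le> 2 ^ k"
  shows "length (asked orc (build_tree n kc kb Ms Bs)) \<le> length Ms * (n * (k * kc))"
proof (induction Ms arbitrary: Bs)
  case (Cons M Ms)
  have "(\<Sum>y\<leftarrow>[0..<n]. length (asked orc (step_tree n kc kb y (parent_table n M Bs) (Bs ! y))))
      \<le> (\<Sum>y\<leftarrow>[0..<n]. k * kc)"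
    using length_asked_step_tree[OF assms] by (intro sum_list_mono) auto
  also have "\<dots> = n * (k * kc)"
    by (simp add: sum_list_triv)
  finally show ?case
    using Cons by (simp add: length_concat comp_def add_mono)
qed simp

lemma set_asked_build_tree:
  "set (asked orc (build_tree n kc kb Ms Bs)) \<subseteq> {..<n} \<times> {..<n} \<times> {..<n}"
proof (induction Ms arbitrary: Bs)
  case (Cons M Ms)
  have "set (asked orc (step_tree n kc kb y (parent_table n M Bs) (Bs ! y))) \<subseteq> {..<n} \<times> {..<n} \<times> {..<n}"
    if "y < n" for y
    using set_asked_step_tree[of orc n kc kb y "parent_table n M Bs" "Bs ! y"] that by auto
  then show ?case
    using Cons by (simp add: UN_subset_iff)
qed simp

lemma length_parent_table [simp]: "length (parent_table n M Bs) = n"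
  by (simp add: parent_table_def)

lemma set_parent_table:
  assumes "\<And>y. y < n \<Longrightarrow> set (Bs ! y) \<subseteq> {..<n}"
  shows "set (parent_table n M Bs) \<subseteq> {..n}"
proof -
  have "head_or n (Bs ! y) \<le> n" if "y < n" for y
    using assms[OF that] by (auto simp: head_or_def split: list.split)
  then show ?thesis
    by (auto simp: parent_table_def)
qed

lemma outcome_build_tree_tables:
  assumes "\<And>y. y < n \<Longrightarrow> set (Bs ! y) \<subseteq> {..<n}"
  shows "outcome orc (build_tree n kc kb Ms Bs)
    \<in> {tabs. set tabs \<subseteq> {tab. set tab \<subseteq> {..n} \<and> length tab = n} \<and> length tabs = length Ms}"
  using assms
proof (induction Ms arbitrary: Bs)
  case (Cons M Ms)
  let ?Bs = "map (\<lambda>y. outcome orc (step_tree n kc kb y (parent_table n M Bs) (Bs ! y))) [0..<n]"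
  have "set (?Bs ! y) \<subseteq> {..<n}" if "y < n" for y
    using that by (simp add: set_outcome_step_tree)
  from Cons.IH[OF this] show ?case
    using set_parent_table[OF Cons.prems] by simp
qed simp

section \<open>Correctness of the search when the samples are good\<close>

lemma compares_build_oracle: "compares (build_oracle d obj) (\<lambda>x y. d (obj y) (obj x))"
  by (auto simp: compares_def build_oracle_def similarity_oracle_def)

lemma compares_search_oracle:
  "compares (search_oracle d obj q) (\<lambda>x y. d (obj y) (ref_object obj q x))"
  by (auto simp: compares_def search_oracle_def similarity_oracle_def)

text \<open>\<open>height\<close> says that \<rho> has dropped to at most \<open>L\<close> at level
  \<open>h + 1\<close>, so that all of T can serve as the last sample; \<open>below_height\<close>
  keeps the sampling probabilities of the levels 1 to \<open>h\<close> below 1.\<close>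

locale search_instance = ranked_set d S
  for d :: "'a \<Rightarrow> 'a \<Rightarrow> real" and S :: "'a set" +
  fixes n E L h :: nat and obj :: "nat \<Rightarrow> 'a" and q :: 'a
  assumes n_pos: "0 < n" and E_pos: "1 \<le> E" and L_pos: "1 \<le> L"
    and inj_obj: "inj_on obj {..<n}"
    and S_eq: "S = insert q (obj ` {..<n})"
    and disorder: "disorder_inequalities d S (real E)"
    and height: "n \<le> L * (17 * E) ^ Suc h"
    and below_height: "\<And>i. 1 \<le> i \<Longrightarrow> i \<le> h \<Longrightarrow> L * (17 * E) ^ i < n"
begin

definition radius :: "nat \<Rightarrow> real" where
  "radius i = real n / (17 * real E) ^ i"

definition close :: "'a \<Rightarrow> real \<Rightarrow> nat set \<Rightarrow> nat set" where
  "close x \<rho> M = {y \<in> M. real (rank x (obj y)) \<le> \<rho>}"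

text \<open>Level 0 is a fixed singleton, so every search starts from the beam \<open>[0]\<close>
  without asking anything.\<close>

definition levels :: "(nat \<Rightarrow> nat set) \<Rightarrow> bool" where
  "levels lev \<longleftrightarrow> lev 0 = {0} \<and> lev (Suc h) = {..<n} \<and> (\<forall>i. lev i \<subseteq> {..<n})"

text \<open>
  The radius \<open>306 E\<^sup>3 \<rho>\<^sub>i = E (17 E \<rho>\<^sub>i\<^sub>-\<^sub>1 + E \<rho>\<^sub>i\<^sub>-\<^sub>1)\<close> bounds the ranks of the children of a beam of
  level \<open>i - 1\<close>.
\<close>

definition good_samples :: "(nat \<Rightarrow> nat set) \<Rightarrow> bool" where
  "good_samples lev \<longleftrightarrow> (\<forall>x\<in>S. \<forall>i\<in>{1..h}.
     card (close x (2 * E * radius i) (lev i)) \<le> 7 * E * L \<and>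
     (real n \<le> 17 * E * radius i \<or> 7 * E * L \<le> card (close x (17 * E * radius i) (lev i))) \<and>
     close x (radius i) (lev i) \<noteq> {} \<and>
     card (close x (306 * E ^ 3 * radius i) (lev i)) \<le> 615 * E ^ 3 * L)"

text \<open>The search invariant: the beam lies between two balls of the level. Sortedness makes its
  head the nearest sample.\<close>

definition good_beam :: "(nat \<Rightarrow> nat set) \<Rightarrow> 'a \<Rightarrow> nat \<Rightarrow> nat list \<Rightarrow> bool" where
  "good_beam lev x i B \<longleftrightarrow>
     set B \<subseteq> lev i \<and> sorted (map (\<lambda>y. d (obj y) x) B) \<and>
     close x (2 * E * radius i) (lev i) \<subseteq> set B \<and>
     (\<forall>y\<in>set B. real (rank x (obj y)) \<le> 17 * E * radius i)"

lemma obj_in_S: "y < n \<Longrightarrow> obj y \<in> S"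
  by (simp add: S_eq)

lemma S_cases:
  assumes "y \<in> S"
  obtains "y = q" | j where "j < n" "y = obj j"
  using assms S_eq by blast

lemma card_S_le: "card S \<le> Suc n"
  unfolding S_eq using card_image_le[of "{..<n}" obj]
  by (simp add: card_insert_if)

lemma rank_le_n: "x \<in> S \<Longrightarrow> rank x y \<le> n"
  using rank_less_card[of x y] card_S_le by simp

lemma radius_0 [simp]: "radius 0 = real n"
  by (simp add: radius_def)

lemma radius_Suc: "radius i = 17 * real E * radius (Suc i)"
  using E_pos by (simp add: radius_def)

lemma radius_nonneg: "0 \<le> radius i"
  by (simp add: radius_def)

lemma le_E_times: "0 \<le> a \<Longrightarrow> a \<le> real E * a"
  using mult_right_mono[of 1 "real E" a] E_pos by simp

lemma radius_ge_1:
  assumes "i \<le> h"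
  shows "1 \<le> radius i"
proof (cases i)
  case 0
  then show ?thesis using n_pos by simp
next
  case (Suc j)
  have "(17 * E) ^ i \<le> L * (17 * E) ^ i"
    using L_pos by simp
  also have "\<dots> \<le> n"
    using below_height[of i] Suc assms by simp
  finally have "(17 * real E) ^ i \<le> real n"
    by (metis of_nat_le_iff of_nat_mult of_nat_numeral of_nat_power)
  then show ?thesis
    using E_pos by (simp add: radius_def le_divide_eq)
qed

lemma disorder_through:
  assumes "x \<in> S" "y \<in> S" "z \<in> S"
  shows "real (rank x y) \<le> E * (real (rank x z) + real (rank z y))"
    and "real (rank x y) \<le> E * (real (rank x z) + real (rank y z))"
  using disorder[unfolded disorder_inequalities_def, rule_format, OF assms] by blast+

lemma inj_on_dist_obj:
  assumes "x \<in> S"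
  shows "inj_on (\<lambda>y. d (obj y) x) {..<n}"
  using dist_inject[OF assms] obj_in_S inj_onD[OF inj_obj] by (intro inj_onI) blast

text \<open>Ranks are taken in \<open>S\<close>, which may exceed T by \<open>q\<close>. This and
  the rounding of \<rho> to an integer shift the count by at most 1 in each direction.\<close>

lemma card_close_full:
  assumes "x \<in> S" "0 \<le> \<rho>"
  shows "real (card (close x \<rho> {..<n})) \<le> \<rho> + 1"
    and "\<rho> < real n \<Longrightarrow> \<rho> - 1 \<le> real (card (close x \<rho> {..<n}))"
proof -
  define k where "k = nat \<lfloor>\<rho>\<rfloor>"
  have k: "real m \<le> \<rho> \<longleftrightarrow> m \<le> k" for m
    unfolding k_def using assms(2) by (simp add: le_nat_iff le_floor_iff)
  have img: "obj ` close x \<rho> {..<n} \<subseteq> {y \<in> S. rank x y \<le> k}"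
    unfolding close_def by (auto simp: k obj_in_S)
  have "inj_on obj (close x \<rho> {..<n})"
    using inj_obj by (rule inj_on_subset) (auto simp: close_def)
  then have card_img: "card (obj ` close x \<rho> {..<n}) = card (close x \<rho> {..<n})"
    by (rule card_image)
  have "card (close x \<rho> {..<n}) \<le> card {y \<in> S. rank x y \<le> k}"
    unfolding card_img[symmetric] using img finite_S by (intro card_mono) auto
  also have "\<dots> \<le> Suc k"
    unfolding card_rank_le[OF assms(1)] by simp
  finally show "real (card (close x \<rho> {..<n})) \<le> \<rho> + 1"
    using k[of k] by simp
  show "\<rho> - 1 \<le> real (card (close x \<rho> {..<n}))" if "\<rho> < real n"
  proof -
    have "k < n"
      using that k[of k] by linarith
    moreover have "n \<le> card S"
      using card_mono[of S "obj ` {..<n}"] finite_S card_image[OF inj_obj] by (auto simp: S_eq)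
    ultimately have "Suc k = card {y \<in> S. rank x y \<le> k}"
      unfolding card_rank_le[OF assms(1)] by simp
    also have "\<dots> \<le> card (insert q (obj ` close x \<rho> {..<n}))"
    proof (intro card_mono subsetI)
      fix y assume y: "y \<in> {y \<in> S. rank x y \<le> k}"
      then show "y \<in> insert q (obj ` close x \<rho> {..<n})"
        using S_cases[of y] by (auto simp: close_def k)
    qed (simp add: close_def)
    also have "\<dots> \<le> Suc (card (close x \<rho> {..<n}))"
      unfolding card_img[symmetric] by (simp add: card_insert_if close_def)
    finally show ?thesis
      using k[of "Suc k"] by linarith
  qed
qed

text \<open>Level 0 is contained in the beam, and \<rho> = n there bounds every rank.\<close>

lemma good_beam_0:
  assumes "levels lev" "x \<in> S"
  shows "good_beam lev x 0 [0]"
  using assms rank_le_n[OF assms(2), of "obj 0"] le_E_times[of "real n"]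
  by (auto simp: good_beam_def levels_def close_def)

text \<open>The inner ball of a good beam includes the ball of radius \<rho>, which contains a
  sample; the head is at least as near. For database objects this is the quality of the parent
  pointers.\<close>

lemma head_good_beam:
  assumes "levels lev" "good_samples lev" "x \<in> S" "i \<le> h" "good_beam lev x i B"
  shows "head_or n B \<in> lev i" "real (rank x (obj (head_or n B))) \<le> radius i"
proof -
  have "\<exists>y\<in>lev i. real (rank x (obj y)) \<le> radius i"
  proof (cases "i = 0")
    case True
    then show ?thesis
      using assms rank_le_n[OF assms(3)] by (auto simp: levels_def)
  next
    case False
    then have "close x (radius i) (lev i) \<noteq> {}"
      using assms(2-4) by (simp add: good_samples_def)
    then show ?thesis
      by (auto simp: close_def)
  qed
  then obtain y where y: "y \<in> lev i" "real (rank x (obj y)) \<le> radius i"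
    by blast
  then have "real (rank x (obj y)) \<le> 2 * E * radius i"
    using le_E_times[OF radius_nonneg, of i] radius_nonneg[of i] by linarith
  then have "y \<in> set B"
    using assms(5) y(1) by (auto simp: good_beam_def close_def)
  then obtain z zs where B: "B = z # zs"
    by (cases B) auto
  then have "d (obj z) x \<le> d (obj y) x"
    using assms(5) \<open>y \<in> set B\<close> by (auto simp: good_beam_def)
  then have "rank x (obj z) \<le> rank x (obj y)"
    by (rule rank_mono)
  with y(2) show "real (rank x (obj (head_or n B))) \<le> radius i"
    by (simp add: B head_or_def)
  show "head_or n B \<in> lev i"
    using assms(5) by (simp add: B head_or_def good_beam_def)
qed

definition good_table :: "(nat \<Rightarrow> nat set) \<Rightarrow> nat \<Rightarrow> nat list \<Rightarrow> bool" where
  "good_table lev i tab \<longleftrightarrow> (\<forall>y<n. if y \<in> lev (Suc i)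
     then tab ! y \<in> lev i \<and> real (rank (obj y) (obj (tab ! y))) \<le> radius i
     else tab ! y = n)"

lemma good_parent_table:
  assumes "levels lev" "good_samples lev" "i \<le> h"
    and "\<And>y. y < n \<Longrightarrow> good_beam lev (obj y) i (Bs ! y)"
  shows "good_table lev i (parent_table n (lev (Suc i)) Bs)"
  using head_good_beam[OF assms(1,2) obj_in_S assms(3) assms(4)]
  by (simp add: good_table_def parent_table_def)

lemma candidates:
  assumes "levels lev" "good_samples lev" "i \<le> h" "good_table lev i tab"
    and "x \<in> S" "good_beam lev x i B"
  defines "C \<equiv> {y. y < n \<and> tab ! y \<in> set B}"
  shows "C \<subseteq> lev (Suc i)" "close x (radius i) (lev (Suc i)) \<subseteq> C" "card C \<le> 615 * E ^ 3 * L"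
proof -
  have levn: "lev j \<subseteq> {..<n}" for j
    using assms(1) by (simp add: levels_def)
  have B: "set B \<subseteq> {..<n}"
    using assms(6) levn by (auto simp: good_beam_def)
  show C: "C \<subseteq> lev (Suc i)"
  proof
    fix y assume "y \<in> C"
    then have "y < n" "tab ! y \<noteq> n"
      \<comment> \<open>The marker \<open>n\<close> belongs to no beam, so objects outside the next
        level are never children.\<close>
      using B by (auto simp: C_def)
    then show "y \<in> lev (Suc i)"
      using assms(4) by (metis good_table_def)
  qed
  show "close x (radius i) (lev (Suc i)) \<subseteq> C"
  proof
    fix y assume y: "y \<in> close x (radius i) (lev (Suc i))"
    then have yn: "y < n" "y \<in> lev (Suc i)" "real (rank x (obj y)) \<le> radius i"
      using levn by (auto simp: close_def)
    then have p: "tab ! y \<in> lev i" "real (rank (obj y) (obj (tab ! y))) \<le> radius i"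
      using assms(4) by (auto simp: good_table_def)
    \<comment> \<open>The route from \<open>x\<close> to the parent passes through the child
      \<open>y\<close>.\<close>
    have "real (rank x (obj (tab ! y))) \<le>
        E * (real (rank x (obj y)) + real (rank (obj y) (obj (tab ! y))))"
      using p(1) levn yn by (intro disorder_through(1) obj_in_S assms(5)) auto
    also have "\<dots> \<le> E * (radius i + radius i)"
      using yn p by (intro mult_left_mono add_mono) auto
    finally have "tab ! y \<in> close x (2 * E * radius i) (lev i)"
      using p(1) by (simp add: close_def algebra_simps)
    then show "y \<in> C"
      using assms(6) yn by (auto simp: C_def good_beam_def)
  qed
  have "C \<subseteq> close x (306 * E ^ 3 * radius (Suc i)) (lev (Suc i))"
  proof
    fix y assume y: "y \<in> C"
    then have yn: "y < n" "tab ! y \<in> set B" "y \<in> lev (Suc i)"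
      using C by (auto simp: C_def)
    then have p: "tab ! y \<in> lev i" "real (rank (obj y) (obj (tab ! y))) \<le> radius i"
      using assms(4) by (auto simp: good_table_def)
    \<comment> \<open>Now the parent is the intermediate object. Its rank is known about
      \<open>y\<close>, not the rank of \<open>y\<close> about it, which calls for the other form of
      the disorder inequality.\<close>
    have "real (rank x (obj y)) \<le>
        E * (real (rank x (obj (tab ! y))) + real (rank (obj y) (obj (tab ! y))))"
      using p(1) levn yn by (intro disorder_through(2) obj_in_S assms(5)) auto
    \<comment> \<open>The spare factor \<open>E\<close> lets both terms combine to 18 E^2 \<rho> at
      level i; passing to level i + 1 multiplies by 17 E, and 18 * 17 = 306.\<close>
    also have "\<dots> \<le> E * (17 * E * radius i + E * radius i)"
      using yn p assms(6) le_E_times[OF radius_nonneg, of i]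
      by (intro mult_left_mono add_mono) (auto simp: good_beam_def)
    also have "\<dots> = 306 * E ^ 3 * radius (Suc i)"
      unfolding radius_Suc[of i] by (simp add: power3_eq_cube algebra_simps)
    finally show "y \<in> close x (306 * E ^ 3 * radius (Suc i)) (lev (Suc i))"
      using yn by (simp add: close_def)
  qed
  moreover have "finite (close x \<rho> (lev j))" for \<rho> j
    using finite_subset[OF levn] by (simp add: close_def)
  ultimately have "card C \<le> card (close x (306 * E ^ 3 * radius (Suc i)) (lev (Suc i)))"
    by (intro card_mono)
  also have "\<dots> \<le> 615 * E ^ 3 * L"
  proof (cases "i = h")
    case False
    then show ?thesis
      using assms(2,3,5) by (simp add: good_samples_def)
  next
    \<comment> \<open>The last level is not random: all of T is counted directly, with \<rho> at
      most \<open>L\<close>.\<close>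
    case True
    have "radius (Suc h) \<le> L"
    proof -
      have "real n \<le> real (L * (17 * E) ^ Suc h)"
        using height by (simp only: of_nat_le_iff)
      then show ?thesis
        using E_pos by (simp add: radius_def divide_le_eq)
    qed
    then have "306 * E ^ 3 * radius (Suc h) \<le> real (306 * E ^ 3) * L"
      by (intro mult_left_mono) auto
    moreover have "real 1 \<le> real (E ^ 3 * L)"
      unfolding of_nat_le_iff using E_pos L_pos by simp
    moreover have "real (card (close x (306 * E ^ 3 * radius (Suc h)) {..<n}))
        \<le> 306 * E ^ 3 * radius (Suc h) + 1"
      using assms(5) radius_nonneg by (intro card_close_full(1)) auto
    ultimately have "real (card (close x (306 * E ^ 3 * radius (Suc h)) {..<n})) \<le>
        615 * real (E ^ 3 * L)"
      by simp
    also have "\<dots> = real (615 * E ^ 3 * L)"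
      by simp
    finally show ?thesis
      unfolding of_nat_le_iff using assms(1) True by (simp add: levels_def)
  qed
  finally show "card C \<le> 615 * E ^ 3 * L" .
qed

text \<open>Below the cap the truncation is void, so all children are sorted and the new beam is
  described by counting nearer children.\<close>

lemma step_tree_sorts:
  assumes "compares orc key" "\<And>y. key r y = d (obj y) x" "x \<in> S"
    and "card {y. y < n \<and> tab ! y \<in> set B} \<le> kc"
  obtains ys where "outcome orc (step_tree n kc kb r tab B) = take kb ys"
    "set ys = {y. y < n \<and> tab ! y \<in> set B}" "sorted (map (\<lambda>y. d (obj y) x) ys)"
    "\<And>z. z \<in> set (take kb ys) \<longleftrightarrow>
       z \<in> set ys \<and> card {w \<in> set ys. d (obj w) x < d (obj z) x} < kb"
proof -
  let ?us = "filter (\<lambda>y. tab ! y \<in> set B) [0..<n]"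
  have set_us: "set ?us = {y. y < n \<and> tab ! y \<in> set B}"
    by auto
  have "length ?us = card (set ?us)"
    by (intro distinct_card[symmetric]) simp
  then have take: "take kc ?us = ?us"
    using assms(4) set_us by simp
  define ys where "ys = outcome orc (sort_tree r ?us)"
  have key: "key r = (\<lambda>y. d (obj y) x)"
    using assms(2) by auto
  have set_ys: "set ys = {y. y < n \<and> tab ! y \<in> set B}"
    using set_us by (simp add: ys_def)
  have sorted: "sorted (map (\<lambda>y. d (obj y) x) ys)"
    using sorted_outcome_sort_tree[OF assms(1), of r ?us] by (simp add: ys_def key)
  show ?thesis
  proof (rule that)
    show "outcome orc (step_tree n kc kb r tab B) = take kb ys"
      by (simp add: step_tree_def take ys_def del: take_all_iff)
    show "z \<in> set (take kb ys) \<longleftrightarrow>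
       z \<in> set ys \<and> card {w \<in> set ys. d (obj w) x < d (obj z) x} < kb" for z
      using sorted inj_on_subset[OF inj_on_dist_obj[OF assms(3)], of "set ys"] set_ys
      by (intro in_set_take_sorted_iff) (auto simp: ys_def)
  qed fact+
qed

text \<open>All samples within 17 E \<rho> at level i + 1 are children, as this radius equals \<rho>
  at level i. A child beyond it is preceded by at least 7 E L of them and falls outside the beam; a
  sample in the inner ball is preceded only by others of that ball, fewer than 7 E L.\<close>

lemma good_beam_step:
  assumes "levels lev" "good_samples lev" "i < h" "good_table lev i tab"
    and "compares orc key" "\<And>y. key r y = d (obj y) x"
    and "x \<in> S" "good_beam lev x i B"
  shows "good_beam lev x (Suc i)
    (outcome orc (step_tree n (615 * E ^ 3 * L) (7 * E * L) r tab B))"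
proof -
  let ?C = "{y. y < n \<and> tab ! y \<in> set B}"
  have ih: "i \<le> h" using assms(3) by simp
  note C = candidates[OF assms(1,2) ih assms(4,7,8)]
  obtain ys where ys: "outcome orc (step_tree n (615 * E ^ 3 * L) (7 * E * L) r tab B) = take (7 * E * L) ys"
    "set ys = ?C" "sorted (map (\<lambda>y. d (obj y) x) ys)"
    "\<And>z. z \<in> set (take (7 * E * L) ys) \<longleftrightarrow>
       z \<in> set ys \<and> card {w \<in> set ys. d (obj w) x < d (obj z) x} < 7 * E * L"
    using step_tree_sorts[OF assms(5,6,7) C(3)] by blast
  have levn: "lev j \<subseteq> {..<n}" for j
    using assms(1) by (simp add: levels_def)
  have fin: "finite (close x \<rho> (lev j))" for \<rho> j
    using finite_subset[OF levn] by (simp add: close_def)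
  have G: "card (close x (2 * E * radius (Suc i)) (lev (Suc i))) \<le> 7 * E * L"
    "real n \<le> 17 * E * radius (Suc i) \<or>
       7 * E * L \<le> card (close x (17 * E * radius (Suc i)) (lev (Suc i)))"
    using assms(2,3,7) by (auto simp: good_samples_def)
  have sub: "close x (17 * E * radius (Suc i)) (lev (Suc i)) \<subseteq> ?C"
    using C(2) by (simp add: radius_Suc[of i])
  have less: "d (obj w) x < d (obj z) x \<longleftrightarrow> rank x (obj w) < rank x (obj z)"
    if "w < n" "z < n" for w z
    using rank_less_iff assms(7) obj_in_S that by blast
  have "real (rank x (obj z)) \<le> 17 * E * radius (Suc i)" if z: "z \<in> set (take (7 * E * L) ys)" for z
  proof (rule ccontr)
    assume far: "\<not> ?thesis"
    have zn: "z < n"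
      using z ys(2,4) by auto
    \<comment> \<open>The guard in \<open>good_samples\<close> covers radii of at least
      \<open>n\<close>; there no object is far, since ranks never exceed \<open>n\<close>.\<close>
    have "\<not> real n \<le> 17 * E * radius (Suc i)"
      using far rank_le_n[OF assms(7), of "obj z"] by linarith
    then have "7 * E * L \<le> card (close x (17 * E * radius (Suc i)) (lev (Suc i)))"
      using G(2) by blast
    also have "\<dots> \<le> card {w \<in> set ys. d (obj w) x < d (obj z) x}"
    proof (intro card_mono subsetI)
      fix w assume w: "w \<in> close x (17 * E * radius (Suc i)) (lev (Suc i))"
      then have "w \<in> set ys" "w < n"
        using sub ys(2) by auto
      moreover have "rank x (obj w) < rank x (obj z)"
        using w far by (simp add: close_def)
      ultimately show "w \<in> {w \<in> set ys. d (obj w) x < d (obj z) x}"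
        using less zn by simp
    qed simp
    finally show False
      using z ys(4) by simp
  qed
  moreover have "close x (2 * E * radius (Suc i)) (lev (Suc i)) \<subseteq> set (take (7 * E * L) ys)"
  proof
    fix z assume z: "z \<in> close x (2 * E * radius (Suc i)) (lev (Suc i))"
    have "2 * E * radius (Suc i) \<le> 17 * E * radius (Suc i)"
      using radius_nonneg by (intro mult_right_mono) auto
    then have "z \<in> set ys"
      using z sub ys(2) by (auto simp: close_def)
    moreover have zn: "z < n"
      using \<open>z \<in> set ys\<close> ys(2) by simp
    \<comment> \<open>Strict, because \<open>z\<close> lies in the ball but is not nearer than
      itself; thus a ball of exactly 7 E L samples still fits into the beam.\<close>
    have "card {w \<in> set ys. d (obj w) x < d (obj z) x}
        < card (close x (2 * E * radius (Suc i)) (lev (Suc i)))"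
    proof (intro psubset_card_mono fin psubsetI subsetI)
      fix w assume "w \<in> {w \<in> set ys. d (obj w) x < d (obj z) x}"
      then have "w \<in> lev (Suc i)" "rank x (obj w) < rank x (obj z)"
        using C(1) ys(2) less zn by auto
      then show "w \<in> close x (2 * E * radius (Suc i)) (lev (Suc i))"
        using z by (simp add: close_def)
    next
      show "{w \<in> set ys. d (obj w) x < d (obj z) x} \<noteq> close x (2 * E * radius (Suc i)) (lev (Suc i))"
        using z by blast
    qed
    ultimately show "z \<in> set (take (7 * E * L) ys)"
      using G(1) ys(4) by simp
  qed
  moreover have "set (take (7 * E * L) ys) \<subseteq> lev (Suc i)"
    using C(1) ys(2) set_take_subset[of "7 * E * L" ys] by simp
  moreover have "sorted (map (\<lambda>y. d (obj y) x) (take (7 * E * L) ys))"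
    using ys(3) by (simp add: sorted_wrt_take flip: take_map)
  ultimately show ?thesis
    unfolding ys(1) good_beam_def by blast
qed

text \<open>The last level is all of T and \<rho> at level \<open>h\<close> is at least 1. The
  nearest neighbor has rank at most 1 about \<open>q\<close>, so it is a candidate, and the head of
  the sorted candidates is as near.\<close>

lemma nearest_of_final_step:
  assumes "levels lev" "good_samples lev" "good_table lev h tab"
    and "compares orc key" "\<And>y. key r y = d (obj y) q"
    and "good_beam lev q h B"
  defines "z \<equiv> head_or n (outcome orc (step_tree n (615 * E ^ 3 * L) (7 * E * L) r tab B))"
  shows "z < n \<and> nearest_neighbor d (obj ` {..<n}) q (obj z)"
proof -
  have q: "q \<in> S" by (simp add: S_eq)
  let ?C = "{y. y < n \<and> tab ! y \<in> set B}"
  note C = candidates[OF assms(1,2) order_refl assms(3) q assms(6)]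
  obtain ys where ys: "outcome orc (step_tree n (615 * E ^ 3 * L) (7 * E * L) r tab B) = take (7 * E * L) ys"
    "set ys = ?C" "sorted (map (\<lambda>y. d (obj y) q) ys)"
    by (rule step_tree_sorts[OF assms(4,5) q C(3)]) (rule that)
  define m where "m = arg_min_on (\<lambda>y. d (obj y) q) {..<n}"
  have ne: "{..<n} \<noteq> {}" using n_pos by auto
  have m: "m < n" "\<And>y. y < n \<Longrightarrow> d (obj m) q \<le> d (obj y) q"
    using arg_min_if_finite(1)[OF finite_lessThan ne, of "\<lambda>y. d (obj y) q"]
      arg_min_least[OF finite_lessThan ne, of _ "\<lambda>y. d (obj y) q"] by (auto simp: m_def)
  \<comment> \<open>An inclusion suffices: if \<open>q\<close> is itself in the database, the left
    side is empty and the rank is 0.\<close>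
  have "{w \<in> S - {q}. d w q \<le> d (obj m) q} \<subseteq> {obj m}"
  proof
    fix w assume w: "w \<in> {w \<in> S - {q}. d w q \<le> d (obj m) q}"
    then obtain y where "y < n" "w = obj y"
      using S_cases[of w] by blast
    then show "w \<in> {obj m}"
      using m w dist_inject[OF q, of w "obj m"] obj_in_S by (simp add: order_antisym)
  qed
  then have "rank q (obj m) \<le> card {obj m}"
    unfolding obj_rank_def by (intro card_mono) auto
  then have "real (rank q (obj m)) \<le> radius h"
    using radius_ge_1[of h] by simp
  then have "m \<in> set ys"
    using C(2) m(1) assms(1) ys(2) by (auto simp: close_def levels_def)
  then obtain y ys' where y: "ys = y # ys'"
    by (cases ys) auto
  moreover have "0 < 7 * E * L"
    using E_pos L_pos by simp
  ultimately have "z = y"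
    unfolding z_def ys(1) by (cases "7 * E * L") (simp_all add: head_or_def)
  moreover have "y < n" "d (obj y) q \<le> d (obj m) q"
    using ys(2,3) \<open>m \<in> set ys\<close> y by auto
  ultimately show ?thesis
    using m(2) by (force simp: nearest_neighbor_def)
qed

text \<open>Induction on the remaining levels, generalized over the beams: building and searching
  advance in step, the good beams of all objects yielding the good table with which the beam of
  \<open>q\<close> moves on.\<close>

lemma search_outcome_nearest:
  assumes "levels lev" "good_samples lev" "i \<le> h"
    and "\<And>y. y < n \<Longrightarrow> good_beam lev (obj y) i (Bs ! y)" "good_beam lev q i B"
  defines "kc \<equiv> 615 * E ^ 3 * L" and "kb \<equiv> 7 * E * L"
  defines "z \<equiv> outcome (search_oracle d obj q) (search_tree n kc kb
     (outcome (build_oracle d obj) (build_tree n kc kb (map lev [Suc i..<Suc (Suc h)]) Bs)) B)"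
  shows "z < n \<and> nearest_neighbor d (obj ` {..<n}) q (obj z)"
  using assms(3-5) unfolding z_def
proof (induction "h - i" arbitrary: i Bs B)
  case 0
  then have i: "i = h" by simp
  have tab: "good_table lev h (parent_table n (lev (Suc h)) Bs)"
    using assms(1,2) 0(3) unfolding i by (intro good_parent_table) auto
  show ?case
    using nearest_of_final_step[OF assms(1,2) tab compares_search_oracle[of d obj q],
        where r = Query and B = B] 0(4)
    by (simp add: i kc_def kb_def)
next
  case (Suc j)
  then have i: "i < h" "[Suc i..<Suc (Suc h)] = Suc i # [Suc (Suc i)..<Suc (Suc h)]"
    by (simp_all add: upt_conv_Cons)
  let ?tab = "parent_table n (lev (Suc i)) Bs"
  let ?Bs = "map (\<lambda>y. outcome (build_oracle d obj) (step_tree n kc kb y ?tab (Bs ! y))) [0..<n]"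
  let ?B = "outcome (search_oracle d obj q) (step_tree n kc kb Query ?tab B)"
  have tab: "good_table lev i ?tab"
    using assms(1,2) Suc.prems by (intro good_parent_table) auto
  have "good_beam lev (obj y) (Suc i) (?Bs ! y)" if "y < n" for y
    using good_beam_step[OF assms(1,2) i(1) tab compares_build_oracle[of d obj] _
        obj_in_S[OF that] Suc.prems(2)[OF that], where r = y] that
    by (simp add: kc_def kb_def)
  moreover have "good_beam lev q (Suc i) ?B"
    using good_beam_step[OF assms(1,2) i(1) tab compares_search_oracle[of d obj q] _ _
        Suc.prems(3), where r = Query]
    by (simp add: kc_def kb_def S_eq)
  ultimately have "?case" if "j = h - Suc i"
    using Suc.hyps(1)[OF that, of ?Bs ?B] i by (simp del: upt_Suc)
  then show ?case
    using Suc.hyps(2) by simp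
qed

end

section \<open>Random levels\<close>

definition sample_weight :: "nat \<Rightarrow> nat \<Rightarrow> nat \<Rightarrow> nat \<times> nat \<Rightarrow> real" where
  "sample_weight n E L a = real (L * (17 * E) ^ fst a) / real n"

text \<open>One coordinate per pair of level and object: the levels are drawn independently and need
  not be nested.\<close>

definition sample_pmf :: "nat \<Rightarrow> nat \<Rightarrow> nat \<Rightarrow> nat \<Rightarrow> (nat \<times> nat \<Rightarrow> bool) pmf" where
  "sample_pmf n E L h =
     Pi_pmf ({1..h} \<times> {..<n}) False (\<lambda>a. bernoulli_pmf (sample_weight n E L a))"

definition level_of :: "nat \<Rightarrow> nat \<Rightarrow> (nat \<times> nat \<Rightarrow> bool) \<Rightarrow> nat \<Rightarrow> nat set" where
  "level_of n h \<omega> i = (if i = 0 then {0} else if i \<le> h then {y. y < n \<and> \<omega> (i, y)} else {..<n})"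

context search_instance
begin

lemma levels_level_of: "levels (level_of n h \<omega>)"
  using n_pos by (auto simp: levels_def level_of_def)

text \<open>With p the sampling probability, p \<rho> = L, so a ball of radius c \<rho> holds c L
  samples on average, up to an error of at most 1 because p is at most 1.\<close>

lemma prob_close_level:
  assumes "x \<in> S" "i \<in> {1..h}" "0 \<le> c"
  shows "measure_pmf.prob (sample_pmf n E L h)
           {\<omega>. k \<le> real (card (close x (c * radius i) (level_of n h \<omega> i)))}
         \<le> exp (2 * (c * L + 1) - k)"
    and "c * radius i < real n \<Longrightarrow> measure_pmf.prob (sample_pmf n E L h)
           {\<omega>. real (card (close x (c * radius i) (level_of n h \<omega> i))) \<le> k}
         \<le> exp (k - (c * L - 1) / 2)"
proof -
  define p where "p = real (L * (17 * E) ^ i) / real n"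
  define B where "B = {i} \<times> close x (c * radius i) {..<n}"
  have "L * (17 * E) ^ i < n"
    using below_height[of i] assms(2) by simp
  then have p: "0 \<le> p" "p \<le> 1"
    using n_pos unfolding p_def by (auto simp del: of_nat_mult)
  have pr: "p * (c * radius i) = c * L"
    using n_pos E_pos by (simp add: p_def radius_def)
  have sub: "B \<subseteq> {1..h} \<times> {..<n}"
    using assms(2) by (auto simp: B_def close_def)
  have fin: "finite ({1..h} \<times> {..<n})"
    by simp
  have w: "sample_weight n E L a = p" if "a \<in> B" for a
    using that by (auto simp: B_def sample_weight_def p_def)
  have cardB: "card B = card (close x (c * radius i) {..<n})"
    by (simp add: B_def card_cartesian_product_singleton)
  have cards: "card {a \<in> B. \<omega> a} = card (close x (c * radius i) (level_of n h \<omega> i))" for \<omega>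
  proof -
    have "{a \<in> B. \<omega> a} = Pair i ` close x (c * radius i) (level_of n h \<omega> i)"
      using assms(2) by (auto simp: B_def close_def level_of_def)
    then show ?thesis
      by (simp add: card_image inj_on_def)
  qed
  have nonneg: "0 \<le> c * radius i"
    using assms(3) radius_nonneg by simp
  have "p * real (card B) \<le> p * (c * radius i + 1)"
    unfolding cardB using p card_close_full(1)[OF assms(1) nonneg] by (intro mult_left_mono) auto
  also have "\<dots> \<le> c * L + 1"
    using p by (simp add: distrib_left pr)
  finally show "measure_pmf.prob (sample_pmf n E L h)
           {\<omega>. k \<le> real (card (close x (c * radius i) (level_of n h \<omega> i)))}
         \<le> exp (2 * (c * L + 1) - k)"
    using prob_card_ge[where w = "sample_weight n E L" and k = k, OF fin sub w p]
    unfolding cards sample_pmf_def by blast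
  assume "c * radius i < real n"
  have "c * L - 1 \<le> p * (c * radius i - 1)"
    using p by (simp add: right_diff_distrib pr)
  also have "\<dots> \<le> p * real (card B)"
    unfolding cardB using p card_close_full(2)[OF assms(1) nonneg \<open>c * radius i < real n\<close>]
    by (intro mult_left_mono) auto
  finally show "measure_pmf.prob (sample_pmf n E L h)
           {\<omega>. real (card (close x (c * radius i) (level_of n h \<omega> i))) \<le> k}
         \<le> exp (k - (c * L - 1) / 2)"
    using prob_card_le[where w = "sample_weight n E L" and k = k, OF fin sub w p]
    unfolding cards sample_pmf_def by blast
qed

text \<open>Union bound over four bad events for each point and random level.\<close>

lemma prob_good_samples:
  "measure_pmf.prob (sample_pmf n E L h) {\<omega>. good_samples (level_of n h \<omega>)}
     \<ge> 1 - 4 * real (Suc n * h) * exp (- (real L - 1) / 2)"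
proof -
  let ?P = "measure_pmf.prob (sample_pmf n E L h)"
  define \<delta> where "\<delta> = exp (- (real L - 1) / 2)"
  define N where "N c x i \<omega> = card (close x (c * radius i) (level_of n h \<omega> i))" for c x i \<omega>
  define bad where "bad = (\<lambda>(x, i).
     {\<omega>. real (7 * E * L) \<le> real (N (2 * E) x i \<omega>)} \<union>
     {\<omega>. 17 * E * radius i < real n \<and> real (N (17 * E) x i \<omega>) \<le> real (7 * E * L)} \<union>
     {\<omega>. real (N 1 x i \<omega>) \<le> 0} \<union>
     {\<omega>. real (615 * E ^ 3 * L) \<le> real (N (306 * E ^ 3) x i \<omega>)})"
  have EL: "real L \<le> real E * L" "real L \<le> real (E ^ 3) * L" "1 \<le> real L"
    using E_pos L_pos mult_right_mono[of 1 "real E" "real L"] mult_right_mono[of 1 "real (E ^ 3)" "real L"]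
    by auto
  have lin: "2 - 3 * u \<le> - (l - 1) / 2" "1 / 2 - 3 / 2 * u \<le> - (l - 1) / 2"
    if "l \<le> u" "1 \<le> l" for u l :: real
    using that by (simp_all add: field_simps)
  \<comment> \<open>The widths 7 and 615 are placed so that every tail decays: 2 * 2 - 7 = -3, 7 -
    17/2 = -3/2 and 2 * 306 - 615 = -3. The weakest event is an empty ball of radius \<rho>, which
    fixes \<open>\<delta>\<close>.\<close>
  have exponents:
    "2 * (real (2 * E) * L + 1) - real (7 * E * L) = 2 - 3 * (real E * L)"
    "real (7 * E * L) - (real (17 * E) * L - 1) / 2 = 1 / 2 - 3 / 2 * (real E * L)"
    "2 * (real (306 * E ^ 3) * L + 1) - real (615 * E ^ 3 * L) = 2 - 3 * (real (E ^ 3) * L)"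
    "0 - (1 * real L - 1) / 2 = - (real L - 1) / 2"
    by (simp_all add: field_simps)
  have "?P (bad (x, i)) \<le> 4 * \<delta>" if "x \<in> S" "i \<in> {1..h}" for x i
  proof -
    note pc = prob_close_level[OF that, folded N_def]
    have "?P {\<omega>. real (7 * E * L) \<le> real (N (2 * E) x i \<omega>)} \<le> exp (2 * (real (2 * E) * L + 1) - real (7 * E * L))"
      by (rule pc(1)) simp
    also have "\<dots> \<le> \<delta>"
      unfolding \<delta>_def exponents exp_le_cancel_iff by (rule lin[OF EL(1,3)])
    finally have 1: "?P {\<omega>. real (7 * E * L) \<le> real (N (2 * E) x i \<omega>)} \<le> \<delta>" .
    have 2: "?P {\<omega>. 17 * E * radius i < real n \<and> real (N (17 * E) x i \<omega>) \<le> real (7 * E * L)} \<le> \<delta>"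
    proof (cases "17 * E * radius i < real n")
      case True
      then have "?P {\<omega>. real (N (17 * E) x i \<omega>) \<le> real (7 * E * L)}
          \<le> exp (real (7 * E * L) - (real (17 * E) * L - 1) / 2)"
        by (intro pc(2)) simp_all
      also have "\<dots> \<le> \<delta>"
        unfolding \<delta>_def exponents exp_le_cancel_iff by (rule lin[OF EL(1,3)])
      finally show ?thesis
        using True by simp
    next
      case False
      then show ?thesis by (simp add: \<delta>_def)
    qed
    have "radius i < real n"
    proof -
      obtain j where j: "i = Suc j"
        using \<open>i \<in> {1..h}\<close> by (cases i) auto
      have "1 < (17 * real E) ^ i"
        unfolding j using E_pos by (intro one_less_power) auto
      then show ?thesis
        using n_pos by (simp add: radius_def divide_less_eq)
    qed
    then have "?P {\<omega>. real (N 1 x i \<omega>) \<le> 0} \<le> exp (0 - (1 * real L - 1) / 2)"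
      by (intro pc(2)) auto
    then have 3: "?P {\<omega>. real (N 1 x i \<omega>) \<le> 0} \<le> \<delta>"
      by (simp only: \<delta>_def exponents)
    have "?P {\<omega>. real (615 * E ^ 3 * L) \<le> real (N (306 * E ^ 3) x i \<omega>)}
        \<le> exp (2 * (real (306 * E ^ 3) * L + 1) - real (615 * E ^ 3 * L))"
      by (rule pc(1)) simp
    also have "\<dots> \<le> \<delta>"
      unfolding \<delta>_def exponents exp_le_cancel_iff by (rule lin[OF EL(2,3)])
    finally have 4: "?P {\<omega>. real (615 * E ^ 3 * L) \<le> real (N (306 * E ^ 3) x i \<omega>)} \<le> \<delta>" .
    have un: "?P (X \<union> Y) \<le> a + b" if "?P X \<le> a" "?P Y \<le> b" for X Y a b
      using measure_Un_le[of X "sample_pmf n E L h" Y] that by simp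
    have "?P (bad (x, i)) \<le> \<delta> + \<delta> + \<delta> + \<delta>"
      unfolding bad_def prod.case by (intro un 1 2 3 4)
    then show ?thesis by simp
  qed
  then have "(\<Sum>a\<in>S \<times> {1..h}. ?P (bad a)) \<le> real (card (S \<times> {1..h})) * (4 * \<delta>)"
    by (intro sum_bounded_above) auto
  also have "\<dots> \<le> real (Suc n * h) * (4 * \<delta>)"
    using card_S_le by (intro mult_right_mono) (auto simp: card_cartesian_product \<delta>_def simp del: of_nat_mult mult_Suc)
  finally have "(\<Sum>a\<in>S \<times> {1..h}. ?P (bad a)) \<le> 4 * real (Suc n * h) * \<delta>"
    by (simp add: algebra_simps)
  moreover have "?P (\<Union>a\<in>S \<times> {1..h}. bad a) \<le> (\<Sum>a\<in>S \<times> {1..h}. ?P (bad a))"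
    using finite_S by (intro measure_UNION_le) auto
  ultimately have "?P (\<Union>a\<in>S \<times> {1..h}. bad a) \<le> 4 * real (Suc n * h) * \<delta>"
    by linarith
  moreover have "- (\<Union>a\<in>S \<times> {1..h}. bad a) \<subseteq> {\<omega>. good_samples (level_of n h \<omega>)}"
  proof
    fix \<omega> assume *: "\<omega> \<in> - (\<Union>a\<in>S \<times> {1..h}. bad a)"
    have "good_samples (level_of n h \<omega>)"
      unfolding good_samples_def
    proof (intro ballI conjI)
      fix x i assume "x \<in> S" "i \<in> {1..h}"
      then have nb: "\<omega> \<notin> bad (x, i)"
        using * by blast
      show "card (close x (2 * E * radius i) (level_of n h \<omega> i)) \<le> 7 * E * L"
        "real n \<le> 17 * E * radius i \<or>
           7 * E * L \<le> card (close x (17 * E * radius i) (level_of n h \<omega> i))"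
        "card (close x (306 * E ^ 3 * radius i) (level_of n h \<omega> i)) \<le> 615 * E ^ 3 * L"
        using nb unfolding bad_def N_def prod.case Un_iff mem_Collect_eq of_nat_le_iff
        by linarith+
      show "close x (radius i) (level_of n h \<omega> i) \<noteq> {}"
        using nb by (auto simp: bad_def N_def)
    qed
    then show "\<omega> \<in> {\<omega>. good_samples (level_of n h \<omega>)}" by simp
  qed
  then have "?P (- (\<Union>a\<in>S \<times> {1..h}. bad a)) \<le> ?P {\<omega>. good_samples (level_of n h \<omega>)}"
    by (intro measure_pmf.finite_measure_mono) auto
  moreover have "?P (- (\<Union>a\<in>S \<times> {1..h}. bad a)) = 1 - ?P (\<Union>a\<in>S \<times> {1..h}. bad a)"
    using measure_pmf.prob_compl[of "\<Union>a\<in>S \<times> {1..h}. bad a" "sample_pmf n E L h"]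
    by (simp add: Compl_eq_Diff_UNIV)
  ultimately show ?thesis
    unfolding \<delta>_def by linarith
qed

end

section \<open>The data structure and its cost\<close>

definition bits :: "nat \<Rightarrow> nat" where
  "bits m = nat \<lceil>log 2 (real m)\<rceil>"

lemma le_two_power_bits: "m \<le> 2 ^ bits m"
proof (cases "m = 0")
  case False
  have "real m = 2 powr log 2 (real m)"
    using False by simp
  also have "\<dots> \<le> 2 powr real (bits m)"
    unfolding bits_def by (intro powr_mono) linarith+
  also have "\<dots> = real (2 ^ bits m)"
    by (simp add: powr_realpow)
  finally show ?thesis
    unfolding of_nat_le_iff .
qed simp

lemma bits_le_ln:
  assumes "1 \<le> m"
  shows "real (bits m) \<le> 2 * ln (real m) + 1"
proof -
  \<comment> \<open>From ln(1 - 1/2) being at most -1/2.\<close>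
  have "ln 2 \<ge> (1 / 2 :: real)"
    using ln_one_minus_pos_upper_bound[of "1 / 2"]
    by (simp add: ln_div)
  have "0 \<le> log 2 (real m)"
    using assms by simp
  then have "real (bits m) \<le> log 2 (real m) + 1"
    unfolding bits_def by linarith
  also have "log 2 (real m) = ln (real m) / ln 2"
    by (simp add: log_def)
  also have "\<dots> \<le> ln (real m) / (1 / 2)"
    using assms \<open>ln 2 \<ge> 1 / 2\<close> by (intro divide_left_mono) auto
  finally show ?thesis by simp
qed

definition tables :: "nat \<Rightarrow> nat \<Rightarrow> nat list list set" where
  "tables n H = {tabs. set tabs \<subseteq> {tab. set tab \<subseteq> {..n} \<and> length tab = n} \<and> length tabs = H}"

text \<open>Only the number of stored bits matters, so any injection into bit strings will do.\<close>

lemma ex_encoding: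
  "\<exists>f :: nat list list \<Rightarrow> bool list.
     f ` tables n H \<subseteq> {bs. length bs = H * n * bits (Suc n)} \<and> inj_on f (tables n H)"
proof (rule card_le_inj)
  have fin: "finite {tab :: nat list. set tab \<subseteq> {..n} \<and> length tab = n}"
    by (rule finite_lists_length_eq) simp
  then show "finite (tables n H)"
    unfolding tables_def by (rule finite_lists_length_eq)
  have bools: "{bs. length bs = m} = {bs :: bool list. set bs \<subseteq> UNIV \<and> length bs = m}" for m
    by simp
  show "finite {bs :: bool list. length bs = H * n * bits (Suc n)}"
    unfolding bools by (rule finite_lists_length_eq) simp
  have "card (tables n H) = (Suc n ^ n) ^ H"
    unfolding tables_def card_lists_length_eq[OF fin] by (simp add: card_lists_length_eq)
  also have "\<dots> \<le> ((2 ^ bits (Suc n)) ^ n) ^ H"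
    by (intro power_mono le_two_power_bits) auto
  also have "\<dots> = 2 ^ (H * n * bits (Suc n))"
    by (simp add: power_mult[symmetric] mult_ac)
  also have "\<dots> = card {bs :: bool list. length bs = H * n * bits (Suc n)}"
    unfolding bools by (subst card_lists_length_eq) auto
  finally show "card (tables n H) \<le> card {bs :: bool list. length bs = H * n * bits (Suc n)}" .
qed

definition encode :: "nat \<Rightarrow> nat \<Rightarrow> nat list list \<Rightarrow> bool list" where
  "encode n H = (SOME f. f ` tables n H \<subseteq> {bs. length bs = H * n * bits (Suc n)} \<and>
     inj_on f (tables n H))"

lemma encode:
  assumes "tabs \<in> tables n H"
  shows "length (encode n H tabs) = H * n * bits (Suc n)"
    and "inv_into (tables n H) (encode n H) (encode n H tabs) = tabs"
  using someI_ex[OF ex_encoding[of n H]] assms unfolding encode_def by auto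

section \<open>Parameters and the two algorithms\<close>

definition int_disorder :: "real \<Rightarrow> nat" where
  "int_disorder D = nat \<lceil>D\<rceil>"

text \<open>With 12 ln n each bad event has probability at most n^(-6), enough for a union bound
  over all points and levels.\<close>

definition sample_rate :: "nat \<Rightarrow> nat" where
  "sample_rate n = Suc (nat \<lceil>12 * ln (real n)\<rceil>)"

text \<open>The first level after which \<rho> is at most the sampling rate; minimality keeps the
  probabilities of earlier levels below 1.\<close>

definition depth :: "nat \<Rightarrow> real \<Rightarrow> nat" where
  "depth n D = (LEAST h. n \<le> sample_rate n * (17 * int_disorder D) ^ Suc h)"

definition beam_width :: "nat \<Rightarrow> real \<Rightarrow> nat" where
  "beam_width n D = 7 * int_disorder D * sample_rate n"

definition candidate_cap :: "nat \<Rightarrow> real \<Rightarrow> nat" where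
  "candidate_cap n D = 615 * int_disorder D ^ 3 * sample_rate n"

definition nn_build :: "nat \<Rightarrow> real \<Rightarrow> (nat, bool list) dtree pmf" where
  "nn_build n D = map_pmf (\<lambda>\<omega>. bind_tree
       (build_tree n (candidate_cap n D) (beam_width n D)
          (map (level_of n (depth n D) \<omega>) [Suc 0..<Suc (Suc (depth n D))]) (replicate n [0]))
       (\<lambda>tabs. Answer (encode n (Suc (depth n D)) tabs)))
     (sample_pmf n (int_disorder D) (sample_rate n) (depth n D))"

text \<open>Deterministic: all randomness is spent on the samples, and decoding the bits asks
  nothing.\<close>

definition nn_search :: "nat \<Rightarrow> real \<Rightarrow> bool list \<Rightarrow> (ref, nat) dtree pmf" where
  "nn_search n D bs = return_pmf (search_tree n (candidate_cap n D) (beam_width n D)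
     (inv_into (tables n (Suc (depth n D))) (encode n (Suc (depth n D))) bs) [0])"

section \<open>Numerical bounds on cost and failure probability\<close>

lemma ln_ge_1:
  assumes "3 \<le> n"
  shows "1 < ln (real 3)" "ln (real 3) \<le> ln (real n)"
proof -
  have "exp 1 < (3 :: real)"
    using e_less_272 by simp
  then show "1 < ln (real 3)"
    using ln_less_cancel_iff[of "exp 1" "3 :: real"] by simp
qed (use assms in simp)

lemma int_disorder_bounds:
  assumes "1 \<le> D"
  shows "D \<le> real (int_disorder D)" "real (int_disorder D) \<le> 2 * D" "1 \<le> int_disorder D"
  using assms unfolding int_disorder_def by linarith+

text \<open>Minimality of the depth gives (17 E)^h at most n. Both logarithmic bounds follow, since
  17 E is at least 3 and at least 2 D.\<close>

lemma depth_bounds: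
  assumes "3 \<le> n" "1 \<le> D"
  shows "n \<le> sample_rate n * (17 * int_disorder D) ^ Suc (depth n D)"
    and "\<And>i. 1 \<le> i \<Longrightarrow> i \<le> depth n D \<Longrightarrow> sample_rate n * (17 * int_disorder D) ^ i < n"
    and "real (depth n D) \<le> ln (real n)"
    and "real (depth n D) * ln (2 * D) \<le> ln (real n)"
proof -
  let ?E = "int_disorder D" and ?L = "sample_rate n" and ?h = "depth n D"
  have E: "D \<le> real ?E" "1 \<le> ?E"
    using int_disorder_bounds[OF assms(2)] by auto
  \<comment> \<open>The exponent \<open>n\<close> is admissible, so the least one exists.\<close>
  have "n \<le> 1 * 2 ^ n"
    by (simp add: less_imp_le)
  also have "\<dots> \<le> ?L * (17 * ?E) ^ Suc n"
  proof (rule mult_mono)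
    have "(2::nat) ^ n \<le> (17 * ?E) ^ n"
      using E by (intro power_mono) auto
    also have "\<dots> \<le> (17 * ?E) ^ Suc n"
      using E by (intro power_increasing) auto
    finally show "(2::nat) ^ n \<le> (17 * ?E) ^ Suc n" .
  qed (auto simp: sample_rate_def)
  finally show "n \<le> ?L * (17 * ?E) ^ Suc ?h"
    unfolding depth_def by (rule LeastI)
  show below: "?L * (17 * ?E) ^ i < n" if i: "1 \<le> i" "i \<le> ?h" for i
  proof -
    obtain j where j: "i = Suc j" "j < ?h"
      using i by (cases i) auto
    then have "\<not> n \<le> ?L * (17 * ?E) ^ Suc j"
      unfolding depth_def using not_less_Least by blast
    with j show ?thesis by simp
  qed
  have "(17 * ?E) ^ ?h \<le> n"
  proof (cases "?h = 0")
    case True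
    with assms(1) show ?thesis by simp
  next
    case False
    have "(17 * ?E) ^ ?h \<le> ?L * (17 * ?E) ^ ?h"
      by (simp add: sample_rate_def)
    also have "\<dots> \<le> n"
      using False by (intro less_imp_le[OF below[OF _ order_refl]]) simp
    finally show ?thesis .
  qed
  then have "real ((17 * ?E) ^ ?h) \<le> real n"
    by (simp only: of_nat_le_iff)
  then have pow: "(17 * real ?E) ^ ?h \<le> real n"
    by simp
  have ln_le: "real ?h * ln a \<le> ln (real n)" if "0 < a" "a \<le> 17 * real ?E" for a
  proof -
    have "a ^ ?h \<le> real n"
      using power_mono[of a "17 * real ?E" ?h] that pow by linarith
    then have "ln (a ^ ?h) \<le> ln (real n)"
      using that assms(1) by (intro ln_mono) auto
    then show ?thesis
      using that by (simp add: ln_realpow)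
  qed
  show "real ?h * ln (2 * D) \<le> ln (real n)"
    using E assms(2) by (intro ln_le) auto
  have "real ?h * 1 \<le> real ?h * ln 3"
    using ln_ge_1(1)[OF order_refl] by (intro mult_left_mono) auto
  also have "\<dots> \<le> ln (real n)"
    using E by (intro ln_le) auto
  finally show "real ?h \<le> ln (real n)" by simp
qed

lemma cost_bounds:
  obtains C :: real where "0 < C"
    and "\<And>n D. 3 \<le> n \<Longrightarrow> 1 \<le> D \<Longrightarrow>
      real (Suc (depth n D) * (bits (candidate_cap n D) * candidate_cap n D))
        \<le> C * (D ^ 3 * (ln (real n))\<^sup>2 * ln (ln (real n powr (D ^ 3))))"
    and "\<And>n D. 3 \<le> n \<Longrightarrow> 1 \<le> D \<Longrightarrow> D \<le> real n + 1 \<Longrightarrow>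
      real (Suc (depth n D) * n * bits (Suc n)) \<le> C * (real n * (ln (real n))\<^sup>2 / ln (2 * D))"
proof -
  \<comment> \<open>The smallest possible value of the iterated logarithm. It is positive, so
    dividing by it absorbs additive constants into \<open>Q\<close>.\<close>
  define \<gamma> where "\<gamma> = ln (ln (real 3))"
  define Q where "Q = 2 + (2 * ln 68880 + 1) / \<gamma>"
  have \<gamma>: "0 < \<gamma>"
    unfolding \<gamma>_def using ln_ge_1(1)[OF order_refl] by (rule ln_gt_zero)
  have Q: "2 \<le> Q"
    unfolding Q_def using \<gamma> by simp
  have cost: "real (Suc (depth n D) * (bits (candidate_cap n D) * candidate_cap n D))
        \<le> (137760 * Q + 20) * (D ^ 3 * (ln (real n))\<^sup>2 * ln (ln (real n powr (D ^ 3))))"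
    if n: "3 \<le> n" and D: "1 \<le> D" for n D
  proof -
    define l where "l = ln (real n)"
    have l: "1 < l" "ln (real 3) \<le> l"
      using ln_ge_1[OF n] by (auto simp: l_def)
    define t where "t = D ^ 3 * l"
    have D3: "1 \<le> D ^ 3"
      using D by simp
    have t: "l \<le> t"
      unfolding t_def using mult_right_mono[OF D3, of l] l by simp
    define y where "y = ln t"
    have y_eq: "ln (ln (real n powr (D ^ 3))) = y"
      using n by (simp add: ln_powr y_def t_def l_def)
    have "\<gamma> \<le> y"
      unfolding \<gamma>_def y_def using l t ln_ge_1(1)[OF order_refl] by (intro ln_mono) auto
    have "real (sample_rate n) \<le> 14 * l"
      using l unfolding sample_rate_def l_def by linarith
    moreover have "real (int_disorder D) ^ 3 \<le> (2 * D) ^ 3"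
      using int_disorder_bounds[OF D] by (intro power_mono) auto
    ultimately have "real (int_disorder D) ^ 3 * real (sample_rate n) \<le> (2 * D) ^ 3 * (14 * l)"
      using D l by (intro mult_mono) auto
    \<comment> \<open>68880 = 615 * 8 * 14: the cube of E, at most 2 D, gives 8, and the sampling
      rate is at most 14 ln n.\<close>
    then have cap: "real (candidate_cap n D) \<le> 68880 * t"
      by (simp add: candidate_cap_def t_def power_mult_distrib mult_ac)
    have cap1: "1 \<le> candidate_cap n D"
      using int_disorder_bounds(3)[OF D]
      by (intro Suc_leI[of 0, folded One_nat_def]) (simp add: candidate_cap_def sample_rate_def)
    have "real (bits (candidate_cap n D)) \<le> 2 * ln (real (candidate_cap n D)) + 1"
      by (rule bits_le_ln[OF cap1])
    also have "ln (real (candidate_cap n D)) \<le> ln (68880 * t)"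
      using cap cap1 by (intro ln_mono) auto
    also have "ln (68880 * t) = ln 68880 + y"
      using t l by (simp add: ln_mult y_def)
    finally have "real (bits (candidate_cap n D)) \<le> 2 * y + (2 * ln 68880 + 1)"
      by simp
    also have "2 * ln 68880 + 1 = (2 * ln 68880 + 1) / \<gamma> * \<gamma>"
      using \<gamma> by simp
    also have "2 * y + (2 * ln 68880 + 1) / \<gamma> * \<gamma> \<le> 2 * y + (2 * ln 68880 + 1) / \<gamma> * y"
      using \<gamma> \<open>\<gamma> \<le> y\<close> by (intro add_left_mono mult_left_mono) auto
    also have "\<dots> = Q * y"
      by (simp add: Q_def distrib_right)
    finally have bits: "real (bits (candidate_cap n D)) \<le> Q * y" .
    have "real (Suc (depth n D)) \<le> 2 * l"
      using depth_bounds(3)[OF n D] l by (simp add: l_def)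
    then have "real (Suc (depth n D)) * (real (bits (candidate_cap n D)) * real (candidate_cap n D))
        \<le> (2 * l) * ((Q * y) * (68880 * t))"
      using bits cap l Q \<gamma> \<open>\<gamma> \<le> y\<close> by (intro mult_mono mult_nonneg_nonneg) auto
    also have "\<dots> = 137760 * Q * (D ^ 3 * l\<^sup>2 * y)"
      by (simp add: t_def power2_eq_square)
    also have "\<dots> \<le> (137760 * Q + 20) * (D ^ 3 * l\<^sup>2 * y)"
      using D \<gamma> \<open>\<gamma> \<le> y\<close> by (intro mult_right_mono) auto
    finally show ?thesis
      by (simp only: y_eq of_nat_mult) (simp add: l_def)
  qed
  have storage: "real (Suc (depth n D) * n * bits (Suc n))
      \<le> (137760 * Q + 20) * (real n * (ln (real n))\<^sup>2 / ln (2 * D))"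
    if n: "3 \<le> n" and D: "1 \<le> D" "D \<le> real n + 1" for n D
  proof -
    define l where "l = ln (real n)"
    have l: "1 < l"
      using ln_ge_1[OF n] by (auto simp: l_def)
    have ln2D: "0 < ln (2 * D)"
      using D by simp
    have cube: "2 * (real n + 1) \<le> real n ^ 3" "real n + 1 \<le> real n ^ 2"
    proof -
      have "2 * (real n + 1) \<le> 3 * real n"
        using n by simp
      also have "3 * real n \<le> real n ^ 2"
        unfolding power2_eq_square using n by (intro mult_right_mono) auto
      finally have sq: "2 * (real n + 1) \<le> real n ^ 2" .
      also have "\<dots> \<le> real n ^ 3"
        using n by (intro power_increasing) auto
      finally show "2 * (real n + 1) \<le> real n ^ 3" .
      show "real n + 1 \<le> real n ^ 2"
        using sq by simp
    qed
    have "ln (2 * D) \<le> ln (real n ^ 3)"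
      using D cube by (intro ln_mono) auto
    then have "ln (2 * D) \<le> 3 * l"
      using n by (simp add: ln_realpow l_def)
    \<comment> \<open>This absorbs the extra level in \<open>Suc (depth n D)\<close>: the quotient l
      / ln(2D) is bounded below because D is at most n + 1.\<close>
    then have "1 \<le> 3 * l / ln (2 * D)"
      using ln2D by simp
    moreover have "real (depth n D) \<le> l / ln (2 * D)"
      using depth_bounds(4)[OF n D(1)] ln2D by (simp add: l_def le_divide_eq)
    ultimately have depth: "real (Suc (depth n D)) \<le> 4 * l / ln (2 * D)"
      by simp
    have "ln (real n + 1) \<le> ln (real n ^ 2)"
      using cube n by (intro ln_mono) auto
    then have "ln (real (Suc n)) \<le> 2 * l"
      using n by (simp add: ln_realpow l_def add.commute)
    then have "real (bits (Suc n)) \<le> 5 * l"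
      using bits_le_ln[of "Suc n"] l by simp
    then have "real (Suc (depth n D)) * real n * real (bits (Suc n))
        \<le> (4 * l / ln (2 * D)) * real n * (5 * l)"
      using depth l ln2D by (intro mult_mono mult_nonneg_nonneg) auto
    also have "\<dots> = 20 * (real n * l\<^sup>2 / ln (2 * D))"
      by (simp add: power2_eq_square)
    also have "\<dots> \<le> (137760 * Q + 20) * (real n * l\<^sup>2 / ln (2 * D))"
      using Q ln2D by (intro mult_right_mono) auto
    finally show ?thesis
      by (simp only: of_nat_mult l_def)
  qed
  show ?thesis
    by (rule that[of "137760 * Q + 20"]) (use Q cost storage in auto)
qed

text \<open>The number of bad events is at most n^5, each of probability at most n^(-6).\<close>

lemma failure_bound:
  assumes "3 \<le> n" "real h \<le> ln (real n)"
  shows "4 * real (Suc n * h) * exp (- (real (sample_rate n) - 1) / 2) \<le> 1 / real n"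
proof -
  have pos: "0 < real n"
    using assms(1) by simp
  have "12 * ln (real n) \<le> real (sample_rate n) - 1"
    unfolding sample_rate_def by linarith
  then have "exp (- (real (sample_rate n) - 1) / 2) \<le> exp (- (6 * ln (real n)))"
    by simp
  also have "\<dots> = 1 / real n ^ 6"
    using pos exp_of_nat_mult[of 6 "ln (real n)"] by (simp add: exp_minus inverse_eq_divide)
  finally have e: "exp (- (real (sample_rate n) - 1) / 2) \<le> 1 / real n ^ 6" .
  have "real h \<le> real n"
    using assms ln_bound[OF pos] by linarith
  then have "4 * real (Suc n * h) \<le> 4 * (real n + 1) * real n"
    using mult_left_mono[of "real h" "real n" "4 * (real n + 1)"] by (simp add: algebra_simps)
  also have "\<dots> \<le> (real n ^ 3 * real n) * real n"
  proof (rule mult_right_mono)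
    have "4 * (real n + 1) \<le> 27 * real n"
      using assms(1) by simp
    also have "\<dots> \<le> real n ^ 3 * real n"
      using power_mono[of 3 "real n" 3] assms(1) by (intro mult_right_mono) auto
    finally show "4 * (real n + 1) \<le> real n ^ 3 * real n" .
  qed simp
  also have "\<dots> = real n ^ 5"
    by (simp add: eval_nat_numeral)
  finally have "4 * real (Suc n * h) \<le> real n ^ 5" .
  then have "4 * real (Suc n * h) * exp (- (real (sample_rate n) - 1) / 2) \<le> real n ^ 5 * (1 / real n ^ 6)"
    using e by (intro mult_mono) auto
  also have "\<dots> = 1 / real n"
    using pos by (simp add: field_simps eval_nat_numeral)
  finally show ?thesis .
qed

section \<open>Assembly for a hidden space\<close>

lemma search_instance_hidden_space:
  assumes "3 \<le> n" "hidden_space K d" "T \<subseteq> K" "bij_betw obj {..<n} T" "q \<in> K"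
    and D: "D = rank_disorder d (T \<union> {q})"
  shows "1 \<le> D" "D \<le> real n + 1"
    and "search_instance d (T \<union> {q}) n (int_disorder D) (sample_rate n) (depth n D) obj q"
proof -
  have T: "T = obj ` {..<n}" and inj: "inj_on obj {..<n}"
    using assms(4) by (auto simp: bij_betw_def)
  interpret ranked_set d "T \<union> {q}"
    using assms(2,3,5) by (intro ranked_set_hidden_space[of K]) (auto simp: T)
  have "obj 0 \<noteq> obj 1"
    using inj assms(1) by (auto dest: inj_onD)
  moreover have "obj 0 \<in> T \<union> {q}" "obj 1 \<in> T \<union> {q}"
    using assms(1) by (auto simp: T)
  ultimately show D1: "1 \<le> D"
    using disorder_inequalities_ge_1[OF rank_disorder_least(1)] unfolding D by blast
  have "card (T \<union> {q}) \<le> Suc n"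
    using card_Un_le[of T "{q}"] card_image[OF inj] by (simp add: T)
  then show "D \<le> real n + 1"
    using rank_disorder_least(2) unfolding D by linarith
  show "search_instance d (T \<union> {q}) n (int_disorder D) (sample_rate n) (depth n D) obj q"
  proof
    show "disorder_inequalities d (T \<union> {q}) (real (int_disorder D))"
      using rank_disorder_least(1) int_disorder_bounds(1)[OF D1] unfolding D
      by (rule disorder_inequalities_mono)
    show "1 \<le> int_disorder D"
      using int_disorder_bounds(3)[OF D1] .
    show "n \<le> sample_rate n * (17 * int_disorder D) ^ Suc (depth n D)"
      using depth_bounds(1)[OF assms(1) D1] .
    show "sample_rate n * (17 * int_disorder D) ^ i < n" if "1 \<le> i" "i \<le> depth n D" for i
      using depth_bounds(2)[OF assms(1) D1 that] .
  qed (use assms(1) inj in \<open>auto simp: T sample_rate_def\<close>)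
qed

theorem theorem1:
  "\<exists>C>0. \<exists>(build :: nat \<Rightarrow> real \<Rightarrow> (nat, bool list) dtree pmf)
          (search :: nat \<Rightarrow> real \<Rightarrow> bool list \<Rightarrow> (ref, nat) dtree pmf).
     \<forall>(n::nat) (K :: 'a set) d T obj q D.
       n \<ge> 3 \<and> hidden_space K d \<and> T \<subseteq> K \<and> card T = n \<and> bij_betw obj {..<n} T \<and> q \<in> K \<and>
       D = rank_disorder d (T \<union> {q}) \<longrightarrow>
       (\<forall>b\<in>set_pmf (build n D).
          set (asked (build_oracle d obj) b) \<subseteq> {..<n} \<times> {..<n} \<times> {..<n} \<and>
          real (length (asked (build_oracle d obj) b))
            \<le> C * (real n * D ^ 3 * (ln (real n))\<^sup>2 * ln (ln (real n powr (D ^ 3)))) \<and>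
          real (length (outcome (build_oracle d obj) b))
            \<le> C * (real n * (ln (real n))\<^sup>2 / ln (2 * D)) \<and>
          (\<forall>s\<in>set_pmf (search n D (outcome (build_oracle d obj) b)).
             set (asked (search_oracle d obj q) s)
               \<subseteq> insert Query (Stored ` {..<n}) \<times> {..<n} \<times> {..<n} \<and>
             real (length (asked (search_oracle d obj q) s))
               \<le> C * (D ^ 3 * (ln (real n))\<^sup>2 * ln (ln (real n powr (D ^ 3)))))) \<and>
       measure_pmf.prob
         (build n D \<bind> (\<lambda>b.
            map_pmf (outcome (search_oracle d obj q))
              (search n D (outcome (build_oracle d obj) b))))
         {i. i < n \<and> nearest_neighbor d T q (obj i)} \<ge> 1 - 1 / real n"
proof -
  obtain C :: real where C: "0 < C"
    "\<And>n D. 3 \<le> n \<Longrightarrow> 1 \<le> D \<Longrightarrow>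
      real (Suc (depth n D) * (bits (candidate_cap n D) * candidate_cap n D))
        \<le> C * (D ^ 3 * (ln (real n))\<^sup>2 * ln (ln (real n powr (D ^ 3))))"
    "\<And>n D. 3 \<le> n \<Longrightarrow> 1 \<le> D \<Longrightarrow> D \<le> real n + 1 \<Longrightarrow>
      real (Suc (depth n D) * n * bits (Suc n)) \<le> C * (real n * (ln (real n))\<^sup>2 / ln (2 * D))"
    using cost_bounds by blast
  show ?thesis
  proof (intro exI[of _ C] conjI exI[of _ nn_build] exI[of _ nn_search] allI impI C(1))
    fix n :: nat and K :: "'a set" and d T obj q D
    assume "n \<ge> 3 \<and> hidden_space K d \<and> T \<subseteq> K \<and> card T = n \<and> bij_betw obj {..<n} T \<and> q \<in> K \<and>
       D = rank_disorder d (T \<union> {q})"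
    then have n: "3 \<le> n" and hyps: "hidden_space K d" "T \<subseteq> K" "bij_betw obj {..<n} T" "q \<in> K"
      "D = rank_disorder d (T \<union> {q})"
      by blast+
    note D = search_instance_hidden_space(1,2)[OF n hyps]
    interpret search_instance d "T \<union> {q}" n "int_disorder D" "sample_rate n" "depth n D" obj q
      by (rule search_instance_hidden_space(3)[OF n hyps])
    let ?h = "depth n D" and ?kc = "candidate_cap n D" and ?kb = "beam_width n D"
    define bt where "bt \<omega> = build_tree n ?kc ?kb (map (level_of n ?h \<omega>) [Suc 0..<Suc (Suc ?h)])
      (replicate n [0])" for \<omega>
    define tabs where "tabs \<omega> = outcome (build_oracle d obj) (bt \<omega>)" for \<omega>
    have tabs: "tabs \<omega> \<in> tables n (Suc ?h)" for \<omega>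
    proof -
      have "set (replicate n [0] ! y) \<subseteq> {..<n}" if "y < n" for y
        using that by auto
      from outcome_build_tree_tables[OF this] show ?thesis
        unfolding tabs_def bt_def tables_def by (simp del: upt_Suc)
    qed
    have build: "nn_build n D = map_pmf (\<lambda>\<omega>. bind_tree (bt \<omega>) (\<lambda>ts. Answer (encode n (Suc ?h) ts)))
        (sample_pmf n (int_disorder D) (sample_rate n) ?h)"
      by (simp add: nn_build_def bt_def)
    have out: "outcome (build_oracle d obj) (bind_tree (bt \<omega>) (\<lambda>ts. Answer (encode n (Suc ?h) ts)))
        = encode n (Suc ?h) (tabs \<omega>)" for \<omega>
      by (simp add: tabs_def)
    have search: "nn_search n D (encode n (Suc ?h) (tabs \<omega>))
        = return_pmf (search_tree n ?kc ?kb (tabs \<omega>) [0])" for \<omega>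
      by (simp add: nn_search_def encode(2)[OF tabs])
    have cap: "?kc \<le> 2 ^ bits ?kc"
      by (rule le_two_power_bits)
    note cost = C(2)[OF n D(1)]
    show "\<forall>b\<in>set_pmf (nn_build n D).
          set (asked (build_oracle d obj) b) \<subseteq> {..<n} \<times> {..<n} \<times> {..<n} \<and>
          real (length (asked (build_oracle d obj) b))
            \<le> C * (real n * D ^ 3 * (ln (real n))\<^sup>2 * ln (ln (real n powr (D ^ 3)))) \<and>
          real (length (outcome (build_oracle d obj) b))
            \<le> C * (real n * (ln (real n))\<^sup>2 / ln (2 * D)) \<and>
          (\<forall>s\<in>set_pmf (nn_search n D (outcome (build_oracle d obj) b)).
             set (asked (search_oracle d obj q) s)
               \<subseteq> insert Query (Stored ` {..<n}) \<times> {..<n} \<times> {..<n} \<and>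
             real (length (asked (search_oracle d obj q) s))
               \<le> C * (D ^ 3 * (ln (real n))\<^sup>2 * ln (ln (real n powr (D ^ 3)))))"
    proof
      fix b assume "b \<in> set_pmf (nn_build n D)"
      then obtain \<omega> where b: "b = bind_tree (bt \<omega>) (\<lambda>ts. Answer (encode n (Suc ?h) ts))"
        unfolding build by auto
      have asked_b: "asked (build_oracle d obj) b = asked (build_oracle d obj) (bt \<omega>)"
        by (simp add: b)
      have out_b: "outcome (build_oracle d obj) b = encode n (Suc ?h) (tabs \<omega>)"
        unfolding b by (rule out)
      have "length (asked (build_oracle d obj) (bt \<omega>)) \<le> Suc ?h * (n * (bits ?kc * ?kc))"
        using length_asked_build_tree[OF cap, of "build_oracle d obj" n ?kb
            "map (level_of n ?h \<omega>) [Suc 0..<Suc (Suc ?h)]" "replicate n [0]"]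
        unfolding bt_def by (simp del: upt_Suc)
      then have "real (length (asked (build_oracle d obj) (bt \<omega>)))
          \<le> real (Suc ?h * (n * (bits ?kc * ?kc)))"
        by (simp only: of_nat_le_iff)
      also have "\<dots> = real n * real (Suc ?h * (bits ?kc * ?kc))"
        by (simp only: of_nat_mult mult_ac)
      \<comment> \<open>Building costs as much as one search for each of the \<open>n\<close>
        objects.\<close>
      also have "\<dots> \<le> real n * (C * (D ^ 3 * (ln (real n))\<^sup>2 * ln (ln (real n powr (D ^ 3)))))"
        using cost by (rule mult_left_mono) simp
      finally have 1: "real (length (asked (build_oracle d obj) (bt \<omega>)))
          \<le> C * (real n * D ^ 3 * (ln (real n))\<^sup>2 * ln (ln (real n powr (D ^ 3))))"
        by (simp only: mult_ac)
      have "length (tabs \<omega>) = Suc ?h"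
        using tabs[of \<omega>] by (simp add: tables_def)
      then have "length (asked (search_oracle d obj q) (search_tree n ?kc ?kb (tabs \<omega>) [0]))
          \<le> Suc ?h * (bits ?kc * ?kc)"
        using length_asked_search_tree[OF cap, of "search_oracle d obj q" n ?kb "tabs \<omega>" "[0]"]
        by (simp only:)
      then have 2: "real (length (asked (search_oracle d obj q) (search_tree n ?kc ?kb (tabs \<omega>) [0])))
          \<le> C * (D ^ 3 * (ln (real n))\<^sup>2 * ln (ln (real n powr (D ^ 3))))"
        using cost by (meson of_nat_le_iff order_trans)
      have 3: "set (asked (search_oracle d obj q) (search_tree n ?kc ?kb (tabs \<omega>) [0]))
          \<subseteq> insert Query (Stored ` {..<n}) \<times> {..<n} \<times> {..<n}"
        by (rule order_trans[OF set_asked_search_tree]) auto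
      have 4: "set (asked (build_oracle d obj) (bt \<omega>)) \<subseteq> {..<n} \<times> {..<n} \<times> {..<n}"
        unfolding bt_def by (rule set_asked_build_tree)
      have 5: "real (length (encode n (Suc ?h) (tabs \<omega>)))
          \<le> C * (real n * (ln (real n))\<^sup>2 / ln (2 * D))"
        unfolding encode(1)[OF tabs] by (rule C(3)[OF n D])
      show "set (asked (build_oracle d obj) b) \<subseteq> {..<n} \<times> {..<n} \<times> {..<n} \<and>
          real (length (asked (build_oracle d obj) b))
            \<le> C * (real n * D ^ 3 * (ln (real n))\<^sup>2 * ln (ln (real n powr (D ^ 3)))) \<and>
          real (length (outcome (build_oracle d obj) b))
            \<le> C * (real n * (ln (real n))\<^sup>2 / ln (2 * D)) \<and>
          (\<forall>s\<in>set_pmf (nn_search n D (outcome (build_oracle d obj) b)).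
             set (asked (search_oracle d obj q) s)
               \<subseteq> insert Query (Stored ` {..<n}) \<times> {..<n} \<times> {..<n} \<and>
             real (length (asked (search_oracle d obj q) s))
               \<le> C * (D ^ 3 * (ln (real n))\<^sup>2 * ln (ln (real n powr (D ^ 3)))))"
        unfolding asked_b out_b search set_return_pmf using 1 2 3 4 5 by blast
    qed
    have T: "T = obj ` {..<n}"
      using hyps(3) by (auto simp: bij_betw_def)
    define found where "found \<omega> = outcome (search_oracle d obj q) (search_tree n ?kc ?kb (tabs \<omega>) [0])"
      for \<omega>
    let ?P = "measure_pmf.prob (sample_pmf n (int_disorder D) (sample_rate n) ?h)"
    have "found \<omega> < n \<and> nearest_neighbor d T q (obj (found \<omega>))"
      if "good_samples (level_of n ?h \<omega>)" for \<omega>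
    proof -
      have "good_beam (level_of n ?h \<omega>) (obj y) 0 (replicate n [0] ! y)" if "y < n" for y
        using good_beam_0[OF levels_level_of obj_in_S[OF that], of \<omega>] that by simp
      moreover have "good_beam (level_of n ?h \<omega>) q 0 [0]"
        by (rule good_beam_0[OF levels_level_of]) simp
      ultimately have "found \<omega> < n \<and> nearest_neighbor d (obj ` {..<n}) q (obj (found \<omega>))"
        unfolding found_def tabs_def bt_def candidate_cap_def beam_width_def
        by (rule search_outcome_nearest[OF levels_level_of that le0])
      then show ?thesis
        by (simp only: T[symmetric])
    qed
    then have "?P {\<omega>. good_samples (level_of n ?h \<omega>)}
        \<le> ?P (found -` {i. i < n \<and> nearest_neighbor d T q (obj i)})"
      by (intro measure_pmf.finite_measure_mono) auto
    moreover have "1 - 1 / real n \<le> ?P {\<omega>. good_samples (level_of n ?h \<omega>)}"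
      using prob_good_samples failure_bound[OF n depth_bounds(3)[OF n D(1)]] by linarith
    \<comment> \<open>Building and searching together are a deterministic function of the sample, so
      the success probability is at least that of good samples.\<close>
    moreover have "nn_build n D \<bind> (\<lambda>b. map_pmf (outcome (search_oracle d obj q))
              (nn_search n D (outcome (build_oracle d obj) b)))
        = map_pmf found (sample_pmf n (int_disorder D) (sample_rate n) ?h)"
      unfolding build bind_map_pmf out search map_return_pmf found_def[symmetric]
      by (simp add: map_pmf_def)
    ultimately show "1 - 1 / real n \<le> measure_pmf.prob
         (nn_build n D \<bind> (\<lambda>b. map_pmf (outcome (search_oracle d obj q))
              (nn_search n D (outcome (build_oracle d obj) b))))
         {i. i < n \<and> nearest_neighbor d T q (obj i)}"
      by simp
  qed
qed

end
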